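(* Let $M$ be a random countable set over the Wiener noise that is local and hit-or-miss stationary. Then $M$ is dense or empty; that is, either $\mathsf{W}$-a.s. $M$ is dense in $\mathbb{R}$, or $\mathsf{W}$-a.s. $M=\emptyset$.
   Context: $\Omega_0:=\{\omega:\mathbb{R}\to\mathbb{R}\text{ continuous},\ \omega(0)=0\}$, with canonical process $B=(B_t)_{t\in\mathbb{R}}$, $B_t(\omega)=\omega(t)$. $\mathsf{W}$ is the completed two-sided Wiener measure: $(B_t)_{t\ge0}$ and $(B_{-t})_{t\ge 0}$ are independent standard Brownian motions under $\mathsf{W}$; its domain $\mathcal{G}$ is the $\mathsf{W}$-completion of the Borel $\sigma$-field of $\Omega_0$ (locally uniform topology). For extended-real $s<t$, $\mathcal{F}_{s,t}$ is the $\sigma$-field generated by the increments of $B$ between the times $s$ and $t$ and by all events of $\mathsf{W}$-probability $0$ or $1$. $\dagger\notin\mathbb{R}$ is a coffin state; $\mathbb{R}^\dagger:=\mathbb{R}\cup\{\dagger\}$ with the $\sigma$-field generated by the Borel sets of $\mathbb{R}$ and $\{\dagger\}$. For a sequence $s=(s_i)_{i\in\mathbb{N}}$ in $\mathbb{R}^\dagger$, $[s]:=\{s_i:i\in\mathbb{N}\}\setminus\{\dagger\}$. A random set is a map $M:\Omega_0\to 2^{\mathbb{R}}$. For a sub-$\sigma$-field $\mathcal{A}$ of $\mathcal{G}$, an $\mathcal{A}$-measurable enumeration of $M$ is a sequence $S=(S_i)_{i\in\mathbb{N}}$ of $\mathcal{A}$-measurable $\mathbb{R}^\dagger$-valued random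 variables with $M=[S]$ $\mathsf{W}$-a.s. $M$ is a random countable set if it has a $\mathcal{G}$-measurable enumeration. A random countable set $M$ is: dense (resp. empty) if $M$ is $\mathsf{W}$-a.s. dense in $\mathbb{R}$ (resp. $\mathsf{W}$-a.s. the empty set); local if for all extended-real $s<t$ the set $M\cap(s,t)$ has an $\mathcal{F}_{s,t}$-measurable enumeration; hit-or-miss stationary if for every $A$ in the $\sigma$-field $\mathfrak{h}$ on $2^{\mathbb{R}}$ generated by the sets $2^{\mathbb{R}\setminus E}$, $E\subset\mathbb{R}$ Borel, the map $\mathbb{R}\ni x\mapsto \mathsf{W}(x+M\in A)$ is constant. *)

theory Defs
  imports "HOL-Probability.Probability"
begin

section \<open>The two-sided path space\<close>

definition path_space :: "(real \<Rightarrow> real) set" ("\<Omega>\<^sub>0") where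
  "\<Omega>\<^sub>0 = {\<omega>. continuous_on UNIV \<omega> \<and> \<omega> 0 = 0}"

(* The topology of locally uniform convergence: a subbase (in fact a base) is given by the
   uniform tubes over compact time sets. *)
definition locally_uniform_topology :: "(real \<Rightarrow> real) topology" where
  "locally_uniform_topology = topology_generated_by
     {{\<omega>' \<in> \<Omega>\<^sub>0. \<forall>t\<in>K. \<bar>\<omega>' t - \<omega> t\<bar> < e} | \<omega> K e. \<omega> \<in> \<Omega>\<^sub>0 \<and> compact K \<and> 0 < e}"

definition path_borel :: "(real \<Rightarrow> real) measure" where
  "path_borel = sigma \<Omega>\<^sub>0 {U. openin locally_uniform_topology U}"

section \<open>Wiener measure\<close>

(* Processes are indexed by all reals for typing reasons only; negative indices are ignored. *)
definition standard_brownian_motion :: "'a measure \<Rightarrow> (real \<Rightarrow> 'a \<Rightarrow> real) \<Rightarrow> bool" where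
  "standard_brownian_motion P X \<longleftrightarrow>
     prob_space P \<and>
     (\<forall>t\<ge>0. X t \<in> borel_measurable P) \<and>
     (AE \<omega> in P. X 0 \<omega> = 0) \<and>
     (AE \<omega> in P. continuous_on {0..} (\<lambda>t. X t \<omega>)) \<and>
     (\<forall>s t. 0 \<le> s \<longrightarrow> s < t \<longrightarrow>
        distributed P lborel (\<lambda>\<omega>. X t \<omega> - X s \<omega>) (normal_density 0 (sqrt (t - s)))) \<and>
     (\<forall>(n::nat) \<tau>. 0 \<le> \<tau> 0 \<longrightarrow> (\<forall>i<n. \<tau> i < \<tau> (Suc i)) \<longrightarrow>
        prob_space.indep_vars P (\<lambda>_. borel) (\<lambda>i \<omega>. X (\<tau> (Suc i)) \<omega> - X (\<tau> i) \<omega>) {..<n})"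

definition two_sided_wiener_measure :: "(real \<Rightarrow> real) measure \<Rightarrow> bool" where
  "two_sided_wiener_measure P \<longleftrightarrow>
     prob_space P \<and> space P = \<Omega>\<^sub>0 \<and> sets P = sets path_borel \<and>
     standard_brownian_motion P (\<lambda>t \<omega>. \<omega> t) \<and>
     standard_brownian_motion P (\<lambda>t \<omega>. \<omega> (- t)) \<and>
     prob_space.indep_var P
       (PiM {0..} (\<lambda>_. borel)) (\<lambda>\<omega>. \<lambda>t\<in>{0..}. \<omega> t)
       (PiM {0..} (\<lambda>_. borel)) (\<lambda>\<omega>. \<lambda>t\<in>{0..}. \<omega> (- t))"

(* These properties determine W uniquely, so a theorem assuming this predicate is a theorem
   about the Wiener measure; its \<sigma>-field sets W is the completed Borel \<sigma>-field of the path space. *)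
definition completed_wiener_measure :: "(real \<Rightarrow> real) measure \<Rightarrow> bool" where
  "completed_wiener_measure W \<longleftrightarrow> (\<exists>P. two_sided_wiener_measure P \<and> W = completion P)"

(* A \<sigma>-field on the path space is encoded as a measure, of which only space and sets matter. *)
definition increment_field ::
    "(real \<Rightarrow> real) measure \<Rightarrow> ereal \<Rightarrow> ereal \<Rightarrow> (real \<Rightarrow> real) measure" where
  "increment_field W s t = sigma \<Omega>\<^sub>0
     ({{\<omega> \<in> \<Omega>\<^sub>0. \<omega> v - \<omega> u \<in> E} | u v E.
         s \<le> ereal u \<and> u \<le> v \<and> ereal v \<le> t \<and> E \<in> sets borel} \<union>
      {N \<in> sets W. emeasure W N = 0 \<or> emeasure W N = 1})"

lemma subalgebra_increment_field:
  assumes "completed_wiener_measure W"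
  shows "subalgebra W (increment_field W s t)"
proof -
  let ?G = "{{\<omega> \<in> \<Omega>\<^sub>0. \<omega> v - \<omega> u \<in> E} | u v E.
      s \<le> ereal u \<and> u \<le> v \<and> ereal v \<le> t \<and> E \<in> sets borel} \<union>
    {N \<in> sets W. emeasure W N = 0 \<or> emeasure W N = 1}"
  obtain P where P: "two_sided_wiener_measure P" and W: "W = completion P"
    using assms by (auto simp: completed_wiener_measure_def)
  have sp: "space W = \<Omega>\<^sub>0"
    using P by (simp add: W two_sided_wiener_measure_def)
  have B: "(\<lambda>\<omega>. \<omega> r) \<in> borel_measurable W" for r :: real
  proof (cases "r \<ge> 0")
    case True
    then show ?thesis
      using P unfolding W two_sided_wiener_measure_def standard_brownian_motion_def
      by (auto intro: measurable_completion)
  next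
    case False
    then have "- r \<ge> 0" by simp
    then have "(\<lambda>\<omega>. \<omega> (- (- r))) \<in> borel_measurable P"
      using P unfolding two_sided_wiener_measure_def standard_brownian_motion_def by blast
    then show ?thesis
      unfolding W by (auto intro: measurable_completion)
  qed
  have "{\<omega> \<in> \<Omega>\<^sub>0. \<omega> v - \<omega> u \<in> E} \<in> sets W" if "E \<in> sets borel" for u v :: real and E
    using measurable_sets[OF borel_measurable_diff[OF B[of v] B[of u]] that]
    by (simp add: vimage_def Int_def sp conj_commute)
  then have G: "?G \<subseteq> sets W" by blast
  then have "sigma_sets \<Omega>\<^sub>0 ?G \<subseteq> sets W"
    using sets.sigma_sets_subset[of ?G W] by (simp only: sp)
  moreover have "?G \<subseteq> Pow \<Omega>\<^sub>0"
    using G sets.space_closed[of W] unfolding sp by (rule subset_trans)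
  ultimately show ?thesis
    unfolding subalgebra_def increment_field_def
    by (simp only: sp space_measure_of sets_measure_of simp_thms)
qed

section \<open>Random countable sets\<close>

(* The real line with a coffin state is the type real option, with None as the coffin. *)
definition coffin_borel :: "real option measure" where
  "coffin_borel = sigma UNIV ({Some ` E | E. E \<in> sets borel} \<union> {{None}})"

definition enum_range :: "(nat \<Rightarrow> real option) \<Rightarrow> real set" where
  "enum_range s = {x. Some x \<in> range s}"

definition measurable_enumeration ::
    "(real \<Rightarrow> real) measure \<Rightarrow> (real \<Rightarrow> real) measure \<Rightarrow> ((real \<Rightarrow> real) \<Rightarrow> real set)
      \<Rightarrow> (nat \<Rightarrow> (real \<Rightarrow> real) \<Rightarrow> real option) \<Rightarrow> bool" where
  "measurable_enumeration W \<A> M S \<longleftrightarrow>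
     (\<forall>i. S i \<in> measurable \<A> coffin_borel) \<and>
     (AE \<omega> in W. M \<omega> = enum_range (\<lambda>i. S i \<omega>))"

definition random_countable_set ::
    "(real \<Rightarrow> real) measure \<Rightarrow> ((real \<Rightarrow> real) \<Rightarrow> real set) \<Rightarrow> bool" where
  "random_countable_set W M \<longleftrightarrow> (\<exists>S. measurable_enumeration W W M S)"

definition dense_random_set ::
    "(real \<Rightarrow> real) measure \<Rightarrow> ((real \<Rightarrow> real) \<Rightarrow> real set) \<Rightarrow> bool" where
  "dense_random_set W M \<longleftrightarrow> (AE \<omega> in W. closure (M \<omega>) = UNIV)"

definition empty_random_set ::
    "(real \<Rightarrow> real) measure \<Rightarrow> ((real \<Rightarrow> real) \<Rightarrow> real set) \<Rightarrow> bool" where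
  "empty_random_set W M \<longleftrightarrow> (AE \<omega> in W. M \<omega> = {})"

definition local_random_set ::
    "(real \<Rightarrow> real) measure \<Rightarrow> ((real \<Rightarrow> real) \<Rightarrow> real set) \<Rightarrow> bool" where
  "local_random_set W M \<longleftrightarrow> (\<forall>s t :: ereal. s < t \<longrightarrow>
     (\<exists>S. measurable_enumeration W (increment_field W s t)
            (\<lambda>\<omega>. M \<omega> \<inter> {x. s < ereal x \<and> ereal x < t}) S))"

definition hit_or_miss_field :: "real set measure" where
  "hit_or_miss_field = sigma UNIV {Pow (UNIV - E) | E. E \<in> sets borel}"

(* For a random countable set M the event below always lies in sets W, since sets W is complete. *)
definition hit_or_miss_stationary ::
    "(real \<Rightarrow> real) measure \<Rightarrow> ((real \<Rightarrow> real) \<Rightarrow> real set) \<Rightarrow> bool" where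
  "hit_or_miss_stationary W M \<longleftrightarrow> (\<forall>A \<in> sets hit_or_miss_field.
     (\<lambda>x::real. emeasure W {\<omega> \<in> space W. (\<lambda>y. x + y) ` M \<omega> \<in> A}) constant_on UNIV)"

end

theory Submission
  imports Defs
begin

text \<open>
  Let \<open>f h\<close> be the probability that \<open>M\<close> misses an open interval of length \<open>h\<close>. Since \<open>M\<close> is countable and
  stationary, no fixed time belongs to \<open>M\<close>; since \<open>M\<close> is local and the noise has independent
  increments, \<open>f\<close> is therefore multiplicative. If \<open>f 1 = 0\<close>, then \<open>f\<close> vanishes on arbitrarily short
  intervals and \<open>M\<close> is dense; if \<open>f 1 = 1\<close>, then \<open>M\<close> is empty. The case \<open>0 < f 1 < 1\<close>, in which \<open>M\<close>
  would be a Poisson process driven by Brownian motion, is impossible: cut an interval of length \<open>L\<close>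
  into \<open>n\<close> pieces. On each piece \<open>M\<close> has a point with probability only \<open>O(1/n)\<close>, while the increment \<open>X\<close>
  of \<open>B\<close> has fourth moment \<open>O(1/n\<^sup>2)\<close>, so the covariance of \<open>exp (i \<theta> X)\<close> with the miss event is \<open>o(1/n)\<close>.
  Multiplying over the pieces, the characteristic function of the increment over the whole interval
  is unchanged by conditioning on the miss event, so that this event is independent of the increment.
  Multiplying over a partition of \<open>[0,1]\<close>, the event that \<open>M\<close> misses \<open>(0,1)\<close> is independent of all
  increments within \<open>[0,1]\<close>, hence of itself.
\<close>

section \<open>Passage to the completion, and finite time grids\<close>

lemma (in prob_space) indep_vars_completion:
  assumes "indep_vars N X I"
  shows "prob_space.indep_vars (completion M) N X I"
proof -
  interpret c: prob_space "completion M" by (rule prob_space_completion)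
  have rv: "\<And>i. i \<in> I \<Longrightarrow> random_variable (N i) (X i)"
    using assms by (auto simp: indep_vars_def2)
  have ind: "indep_sets (\<lambda>i. {X i -` A \<inter> space M |A. A \<in> sets (N i)}) I"
    using assms by (simp add: indep_vars_def2)
  show ?thesis
    unfolding c.indep_vars_def2
  proof (intro conjI ballI c.indep_setsI)
    show "X i \<in> completion M \<rightarrow>\<^sub>M N i" if "i \<in> I" for i
      using rv[OF that] by (rule measurable_completion)
    show "{X i -` A \<inter> space (completion M) |A. A \<in> sets (N i)} \<subseteq> c.events" if "i \<in> I" for i
    proof clarify
      fix A assume "A \<in> sets (N i)"
      then show "X i -` A \<inter> space (completion M) \<in> c.events"
        by (rule measurable_sets[OF measurable_completion[OF rv[OF that]]])
    qed
    fix A J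
    assume J: "J \<noteq> {}" "J \<subseteq> I" "finite J"
      and "\<forall>j\<in>J. A j \<in> {X j -` A \<inter> space (completion M) |A. A \<in> sets (N j)}"
    then have A: "\<forall>j\<in>J. A j \<in> {X j -` A \<inter> space M |A. A \<in> sets (N j)}" by simp
    \<comment> \<open>These events are measurable already before completion, where both measures
      agree.\<close>
    then have ev: "\<And>j. j \<in> J \<Longrightarrow> A j \<in> events"
    proof -
      fix j assume j: "j \<in> J"
      then obtain B where "B \<in> sets (N j)" "A j = X j -` B \<inter> space M" using A by blast
      then show "A j \<in> events" using measurable_sets[OF rv] j J(2) by auto
    qed
    have "prob (\<Inter>j\<in>J. A j) = (\<Prod>j\<in>J. prob (A j))"
      using A J by (intro indep_setsD[OF ind]) auto
    moreover have "(\<Inter>j\<in>J. A j) \<in> events" using ev J by (intro sets.finite_INT) auto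
    ultimately show "c.prob (\<Inter>j\<in>J. A j) = (\<Prod>j\<in>J. c.prob (A j))"
      using ev by simp
  qed
qed

text \<open>Numbering from \<open>0\<close> to \<open>n\<close> yields exactly \<open>n\<close>
  consecutive steps, the format in which \<open>standard_brownian_motion\<close> speaks of
  independent increments.\<close>

lemma finite_set_strict_enumeration:
  fixes T :: "'a::linorder set"
  assumes "finite T" "T \<noteq> {}"
  obtains n \<tau> where "T = \<tau> ` {..n::nat}" "\<And>i. i < n \<Longrightarrow> \<tau> i < \<tau> (Suc i)"
proof -
  define xs where "xs = sorted_list_of_set T"
  have xs: "set xs = T" "sorted_wrt (<) xs" using assms by (auto simp: xs_def)
  then have l: "length xs \<noteq> 0" using assms by auto
  show ?thesis
  proof (rule that[where n="length xs - 1" and \<tau>="\<lambda>i. xs ! i"])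
    show "T = (!) xs ` {..length xs - 1}"
    proof -
      have "{..length xs - 1} = {0..<length xs}" using l by (cases xs) auto
      then show ?thesis using xs(1) nth_image[of "length xs" xs] by simp
    qed
    show "xs ! i < xs ! Suc i" if "i < length xs - 1" for i
      using xs(2) that by (auto simp: sorted_wrt_iff_nth_less)
  qed
qed

lemma strict_steps_less:
  fixes \<tau> :: "nat \<Rightarrow> 'a::linorder"
  assumes "\<And>i. i < n \<Longrightarrow> \<tau> i < \<tau> (Suc i)" "i < j" "j \<le> n"
  shows "\<tau> i < \<tau> j"
  using assms(2,3)
proof (induction j)
  case (Suc j)
  then show ?case
    using assms(1)[of j] by (cases "i = j") (auto intro: less_trans)
qed simp

section \<open>Independence in the Wiener noise\<close>

definition cylinder_field :: "real set \<Rightarrow> (real \<Rightarrow> real) set set" where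
  "cylinder_field T = sigma_sets \<Omega>\<^sub>0
     (\<Union>u\<in>T. \<Union>v\<in>T. {(\<lambda>\<omega>. \<omega> v - \<omega> u) -` E \<inter> \<Omega>\<^sub>0 | E. E \<in> sets borel})"

lemma cylinder_field_mono: "S \<subseteq> T \<Longrightarrow> cylinder_field S \<subseteq> cylinder_field T"
  unfolding cylinder_field_def by (intro sigma_sets_subseteq) blast

lemma cylinder_field_Int:
  assumes "C \<in> cylinder_field T" "D \<in> cylinder_field T"
  shows "C \<inter> D \<in> cylinder_field T"
proof -
  let ?G = "\<Union>u\<in>T. \<Union>v\<in>T. {(\<lambda>\<omega>. \<omega> v - \<omega> u) -` E \<inter> \<Omega>\<^sub>0 | E. E \<in> sets borel}"
  interpret sigma_algebra "\<Omega>\<^sub>0" "sigma_sets \<Omega>\<^sub>0 ?G"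
    by (rule sigma_algebra_sigma_sets) auto
  show ?thesis using assms unfolding cylinder_field_def by (rule Int)
qed

text \<open>Differences of path values telescope: the increment from \<open>\<tau> a\<close> to
  \<open>\<tau> j\<close> is a sum of consecutive steps, and any other increment is a difference of
  two such sums. This reduces the increments on a grid to the consecutive ones, which are
  independent.\<close>

lemma cylinder_field_image_subset:
  fixes \<tau> :: "nat \<Rightarrow> real"
  shows "cylinder_field (\<tau> ` {a..b}) \<subseteq> sigma_sets \<Omega>\<^sub>0
    (\<Union>i\<in>{a..<b}. {(\<lambda>\<omega>. \<omega> (\<tau> (Suc i)) - \<omega> (\<tau> i)) -` E \<inter> \<Omega>\<^sub>0 | E. E \<in> sets borel})"
    (is "_ \<subseteq> sigma_sets _ ?G")
proof -
  have G: "?G \<subseteq> Pow \<Omega>\<^sub>0" by auto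
  let ?N = "sigma \<Omega>\<^sub>0 ?G"
  have setsN: "sets ?N = sigma_sets \<Omega>\<^sub>0 ?G" using G by (rule sets_measure_of)
  have spN: "space ?N = \<Omega>\<^sub>0" using G by (rule space_measure_of)
  have step: "(\<lambda>\<omega>. \<omega> (\<tau> (Suc i)) - \<omega> (\<tau> i)) \<in> borel_measurable ?N" if "i \<in> {a..<b}" for i
    using that by (intro measurableI) (force simp: setsN spN intro!: sigma_sets.Basic)+
  have start: "(\<lambda>\<omega>. \<omega> (\<tau> j) - \<omega> (\<tau> a)) \<in> borel_measurable ?N" if "a \<le> j" "j \<le> b" for j
    using that
  proof (induction j rule: dec_induct)
    case (step j)
    have "(\<lambda>\<omega>. (\<omega> (\<tau> j) - \<omega> (\<tau> a)) + (\<omega> (\<tau> (Suc j)) - \<omega> (\<tau> j))) \<in> borel_measurable ?N"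
      using step by (intro borel_measurable_add \<open>\<And>i. i \<in> {a..<b} \<Longrightarrow> _\<close>) auto
    then show ?case by simp
  qed simp
  have any: "(\<lambda>\<omega>. \<omega> (\<tau> j) - \<omega> (\<tau> i)) \<in> borel_measurable ?N"
    if "i \<in> {a..b}" "j \<in> {a..b}" for i j
  proof -
    have "(\<lambda>\<omega>. (\<omega> (\<tau> j) - \<omega> (\<tau> a)) - (\<omega> (\<tau> i) - \<omega> (\<tau> a))) \<in> borel_measurable ?N"
      using that by (intro borel_measurable_diff start) auto
    then show ?thesis by simp
  qed
  show ?thesis
    unfolding cylinder_field_def
  proof (rule sigma_sets_mono, clarify)
    fix i j and E :: "real set" assume "i \<in> {a..b}" "j \<in> {a..b}" "E \<in> sets borel"
    then have "(\<lambda>\<omega>. \<omega> (\<tau> j) - \<omega> (\<tau> i)) -` E \<inter> space ?N \<in> sets ?N"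
      by (intro measurable_sets[OF any])
    then show "(\<lambda>\<omega>. \<omega> (\<tau> j) - \<omega> (\<tau> i)) -` E \<inter> \<Omega>\<^sub>0 \<in> sigma_sets \<Omega>\<^sub>0 ?G"
      by (simp only: setsN spN)
  qed
qed

locale wiener_noise =
  fixes W P :: "(real \<Rightarrow> real) measure"
  assumes two_sided: "two_sided_wiener_measure P"
    and completion: "W = completion P"

sublocale wiener_noise \<subseteq> prob_space W
  unfolding completion using two_sided
  by (intro prob_space.prob_space_completion) (simp add: two_sided_wiener_measure_def)

context wiener_noise
begin

lemma space_W: "space W = \<Omega>\<^sub>0"
  using two_sided by (simp add: completion two_sided_wiener_measure_def)

lemma completed: "completed_wiener_measure W"
  using two_sided completion by (auto simp: completed_wiener_measure_def)

text \<open>Completeness of \<open>W\<close> turns an almost sure statement into measurability of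
  the exceptional set. Events about \<open>M\<close> are often known only up to such sets.\<close>

lemma negligible_in_sets:
  assumes "AE \<omega> in W. \<omega> \<notin> N" "N \<subseteq> \<Omega>\<^sub>0"
  shows "N \<in> null_sets W"
proof -
  obtain N' where "N' \<in> null_sets W" "{\<omega> \<in> space W. \<not> \<omega> \<notin> N} \<subseteq> N'"
    using assms(1) by (auto simp: eventually_ae_filter)
  moreover have "{\<omega> \<in> space W. \<not> \<omega> \<notin> N} = N" using assms(2) by (auto simp: space_W)
  ultimately show ?thesis
    by (metis completion null_sets_completion_subset)
qed

lemma brownian: "standard_brownian_motion P (\<lambda>t \<omega>. \<omega> t)"
  using two_sided by (simp add: two_sided_wiener_measure_def)

lemma coordinate_measurable: "0 \<le> t \<Longrightarrow> (\<lambda>\<omega>. \<omega> t) \<in> borel_measurable W"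
  using brownian unfolding completion standard_brownian_motion_def
  by (auto intro: measurable_completion)

lemma increment_measurable:
  "0 \<le> s \<Longrightarrow> 0 \<le> t \<Longrightarrow> (\<lambda>\<omega>. \<omega> t - \<omega> s) \<in> borel_measurable W"
  by (intro borel_measurable_diff coordinate_measurable)

lemma increment_distributed:
  assumes "0 \<le> s" "s < t"
  shows "distributed W lborel (\<lambda>\<omega>. \<omega> t - \<omega> s) (normal_density 0 (sqrt (t - s)))"
proof -
  have d: "distributed P lborel (\<lambda>\<omega>. \<omega> t - \<omega> s) (normal_density 0 (sqrt (t - s)))"
    using brownian assms by (auto simp: standard_brownian_motion_def)
  then show ?thesis
    unfolding distributed_def completion
    by (auto simp: distr_completion intro: measurable_completion)
qed

text \<open>The order \<open>(t - s)\<^sup>2\<close> is what matters: summed over \<open>n\<close>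
  equal pieces of a fixed interval it gives \<open>O(1/n)\<close>, whereas the variances would sum
  to a constant.\<close>

lemma increment_fourth_moment:
  assumes "0 \<le> s" "s < t"
  shows "integrable W (\<lambda>\<omega>. (\<omega> t - \<omega> s) ^ 4)"
    and "expectation (\<lambda>\<omega>. (\<omega> t - \<omega> s) ^ 4) = 3 * (t - s)\<^sup>2"
proof -
  note d = increment_distributed[OF assms]
  \<comment> \<open>The fourth moment is the even moment of index 2, with constant
    \<open>4! / (2^2 * 2!) = 3\<close>.\<close>
  note m = normal_moment_even[of "sqrt (t - s)" 0 2]
  show "integrable W (\<lambda>\<omega>. (\<omega> t - \<omega> s) ^ 4)"
    using m assms
    by (subst distributed_integrable[OF d, symmetric]) (auto simp: has_bochner_integral_iff)
  show "expectation (\<lambda>\<omega>. (\<omega> t - \<omega> s) ^ 4) = 3 * (t - s)\<^sup>2"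
    using m assms
    by (subst distributed_integral[OF d, symmetric])
       (auto simp: has_bochner_integral_iff fact_numeral field_simps power2_eq_square)
qed

lemma indep_increments:
  assumes "0 \<le> \<tau> 0" "\<And>i. i < n \<Longrightarrow> \<tau> i < \<tau> (Suc i)"
  shows "indep_vars (\<lambda>_. borel) (\<lambda>i \<omega>. \<omega> (\<tau> (Suc i)) - \<omega> (\<tau> i)) {..<n::nat}"
proof -
  interpret P: prob_space P using two_sided by (simp add: two_sided_wiener_measure_def)
  have "P.indep_vars (\<lambda>_. borel) (\<lambda>i \<omega>. \<omega> (\<tau> (Suc i)) - \<omega> (\<tau> i)) {..<n}"
    using brownian assms unfolding standard_brownian_motion_def by blast
  then show ?thesis unfolding completion by (rule P.indep_vars_completion)
qed

lemma cylinder_field_events: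
  assumes "T \<subseteq> {0..}"
  shows "cylinder_field T \<subseteq> events"
proof -
  have "(\<lambda>\<omega>. \<omega> v - \<omega> u) -` E \<inter> \<Omega>\<^sub>0 \<in> events" if "u \<in> T" "v \<in> T" "E \<in> sets borel" for u v E
    using measurable_sets[OF increment_measurable[of u v] that(3)] that assms
    by (auto simp: space_W)
  then show ?thesis
    unfolding cylinder_field_def
    by (subst space_W[symmetric], intro sets.sigma_sets_subset) (auto simp: space_W)
qed

text \<open>Once the separating time \<open>s\<close> is added to the grid, no consecutive step
  straddles it. The steps before index \<open>k\<close> and those from \<open>k\<close> on are
  disjoint groups of independent variables, and the two fields lie in what these groups
  generate.\<close>

lemma indep_cylinder_fields:
  assumes fin: "finite T1" "finite T2"
    and T1: "T1 \<subseteq> {0..s}" and T2: "T2 \<subseteq> {s..}" and s: "0 \<le> s"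
    and C: "C \<in> cylinder_field T1" and D: "D \<in> cylinder_field T2"
  shows "prob (C \<inter> D) = prob C * prob D"
proof -
  obtain n \<tau> where T: "insert s (T1 \<union> T2) = \<tau> ` {..n::nat}"
    and step: "\<And>i. i < n \<Longrightarrow> \<tau> i < \<tau> (Suc i)"
    by (rule finite_set_strict_enumeration[of "insert s (T1 \<union> T2)"]) (use fin in auto)
  note less = strict_steps_less[of n \<tau>, OF step]
  obtain k where k: "k \<le> n" "\<tau> k = s" using T by (metis atMost_iff imageE insertI1)
  have T1': "T1 \<subseteq> \<tau> ` {0..k}"
  proof
    fix u assume u: "u \<in> T1"
    then obtain i where i: "i \<le> n" "u = \<tau> i"
      using T by (metis UnI1 atMost_iff imageE insertI2)
    have "\<not> k < i" using less[of k i] i u T1 k by fastforce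
    then show "u \<in> \<tau> ` {0..k}" using i by auto
  qed
  have T2': "T2 \<subseteq> \<tau> ` {k..n}"
  proof
    fix u assume u: "u \<in> T2"
    then obtain i where i: "i \<le> n" "u = \<tau> i"
      using T by (metis UnI2 atMost_iff imageE insertI2)
    have "\<not> i < k" using less[of i k] i u T2 k by fastforce
    then show "u \<in> \<tau> ` {k..n}" using i by auto
  qed
  have "\<tau> 0 \<in> insert s (T1 \<union> T2)" using T by auto
  then have pos: "0 \<le> \<tau> 0" using T1 T2 s by (auto dest!: subsetD)
  let ?E = "\<lambda>i. {(\<lambda>\<omega>. \<omega> (\<tau> (Suc i)) - \<omega> (\<tau> i)) -` E \<inter> \<Omega>\<^sub>0 | E. E \<in> sets borel}"
  let ?I = "case_bool {0..<k} {k..<n}"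
  have "indep_sets ?E {..<n}"
    using indep_increments[of \<tau> n, OF pos step] by (simp add: indep_vars_def2 space_W)
  moreover have "(\<Union>j\<in>UNIV. ?I j) = {..<n}" using k by (auto simp: UNIV_bool)
  moreover have "Int_stable (?E i)" for i
    unfolding Int_stable_def
  proof clarify
    fix E E' :: "real set" assume "E \<in> sets borel" "E' \<in> sets borel"
    then show "\<exists>F. (\<lambda>\<omega>. \<omega> (\<tau> (Suc i)) - \<omega> (\<tau> i)) -` E \<inter> \<Omega>\<^sub>0 \<inter>
        ((\<lambda>\<omega>. \<omega> (\<tau> (Suc i)) - \<omega> (\<tau> i)) -` E' \<inter> \<Omega>\<^sub>0)
        = (\<lambda>\<omega>. \<omega> (\<tau> (Suc i)) - \<omega> (\<tau> i)) -` F \<inter> \<Omega>\<^sub>0 \<and> F \<in> sets borel"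
      by (intro exI[of _ "E \<inter> E'"]) auto
  qed
  moreover have "disjoint_family_on ?I UNIV" by (auto simp: disjoint_family_on_def split: bool.split)
  ultimately have ind: "indep_sets (\<lambda>j. sigma_sets \<Omega>\<^sub>0 (\<Union>i\<in>?I j. ?E i)) UNIV"
    using indep_sets_collect_sigma[of ?E ?I UNIV] by (simp add: space_W)
  have "C \<in> sigma_sets \<Omega>\<^sub>0 (\<Union>i\<in>?I True. ?E i)"
    using C cylinder_field_mono[OF T1'] cylinder_field_image_subset[of \<tau> 0 k] by auto
  moreover have "D \<in> sigma_sets \<Omega>\<^sub>0 (\<Union>i\<in>?I False. ?E i)"
    using D cylinder_field_mono[OF T2'] cylinder_field_image_subset[of \<tau> k n] by auto
  ultimately have "prob (\<Inter>j\<in>UNIV. case_bool C D j) = (\<Prod>j\<in>UNIV. prob (case_bool C D j))"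
    by (intro indep_setsD[OF ind]) (auto split: bool.split)
  then show ?thesis by (simp add: UNIV_bool ac_simps)
qed

end

lemma enum_range_empty_iff: "enum_range f = {} \<longleftrightarrow> (\<forall>i. f i = None)"
proof (intro iffI allI)
  fix i assume e: "enum_range f = {}"
  show "f i = None"
  proof (cases "f i")
    case (Some a)
    then have "Some a \<in> range f" by (metis rangeI)
    then have "a \<in> enum_range f" by (simp add: enum_range_def)
    then show ?thesis using e by simp
  qed
qed (auto simp: enum_range_def)

section \<open>From finitely many times to the increment fields of intervals\<close>

context wiener_noise
begin

abbreviation noise_field :: "real \<Rightarrow> real \<Rightarrow> (real \<Rightarrow> real) set set" where
  "noise_field s t \<equiv> sets (increment_field W (ereal s) (ereal t))"

lemma space_increment_field: "space (increment_field W a b) = \<Omega>\<^sub>0"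
  by (simp add: increment_field_def space_measure_of_conv)

lemma noise_field_events: "noise_field s t \<subseteq> events"
  using subalgebra_increment_field[OF completed] by (simp add: subalgebra_def)

lemma noise_field_eq:
  "noise_field s t = sigma_sets \<Omega>\<^sub>0
     ({{\<omega> \<in> \<Omega>\<^sub>0. \<omega> v - \<omega> u \<in> E} | u v E. s \<le> u \<and> u \<le> v \<and> v \<le> t \<and> E \<in> sets borel} \<union>
      {N \<in> events. emeasure W N = 0 \<or> emeasure W N = 1})"
proof -
  have "N \<subseteq> \<Omega>\<^sub>0" if "N \<in> events" for N
    using sets.sets_into_space[OF that] by (simp add: space_W)
  then show ?thesis
    unfolding increment_field_def by (subst sets_measure_of) auto
qed

lemma trivial_in_noise_field:
  assumes "N \<in> events" "prob N = 0 \<or> prob N = 1"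
  shows "N \<in> noise_field s t"
  unfolding noise_field_eq using assms
  by (intro sigma_sets.Basic UnI2) (auto simp: emeasure_eq_measure)

lemma increment_in_noise_field:
  assumes "s \<le> u" "u \<le> v" "v \<le> t"
  shows "(\<lambda>\<omega>. \<omega> v - \<omega> u) \<in> borel_measurable (increment_field W (ereal s) (ereal t))"
proof (rule measurableI)
  fix E :: "real set" assume "E \<in> sets borel"
  then have "{\<omega> \<in> \<Omega>\<^sub>0. \<omega> v - \<omega> u \<in> E} \<in> noise_field s t"
    unfolding noise_field_eq using assms by (intro sigma_sets.Basic UnI1) blast
  then show "(\<lambda>\<omega>. \<omega> v - \<omega> u) -` E \<inter> space (increment_field W (ereal s) (ereal t)) \<in> noise_field s t"
    by (simp add: space_increment_field vimage_def Int_def conj_commute)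
qed simp

lemma noise_field_mono:
  assumes "s' \<le> s" "t \<le> t'"
  shows "noise_field s t \<subseteq> noise_field s' t'"
  unfolding noise_field_eq
proof (rule sigma_sets_subseteq, rule Un_mono[OF _ order_refl], clarify)
  fix u v :: real and E :: "real set"
  assume "s \<le> u" "u \<le> v" "v \<le> t" "E \<in> sets borel"
  then show "\<exists>u' v' E'. {\<omega> \<in> \<Omega>\<^sub>0. \<omega> v - \<omega> u \<in> E} = {\<omega> \<in> \<Omega>\<^sub>0. \<omega> v' - \<omega> u' \<in> E'}
      \<and> s' \<le> u' \<and> u' \<le> v' \<and> v' \<le> t' \<and> E' \<in> sets borel"
    using assms by (intro exI[of _ u] exI[of _ v] exI[of _ E]) auto
qed

text \<open>\<open>increment_field\<close> contains all null events, so an event may be altered by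
  the two negligible sets \<open>X - E\<close> and \<open>E - X\<close>.\<close>

lemma noise_field_AE_cong:
  assumes E: "E \<in> noise_field s t" and X: "X \<subseteq> \<Omega>\<^sub>0" and eq: "AE \<omega> in W. \<omega> \<in> X \<longleftrightarrow> \<omega> \<in> E"
  shows "X \<in> noise_field s t"
proof -
  have EO: "E \<subseteq> \<Omega>\<^sub>0" using sets.sets_into_space[OF E] by (simp add: space_increment_field)
  have "X - E \<in> null_sets W" "E - X \<in> null_sets W"
    using eq X EO by (auto intro!: negligible_in_sets elim: eventually_mono)
  then have "X - E \<in> noise_field s t" "E - X \<in> noise_field s t"
    by (auto intro!: trivial_in_noise_field simp: null_sets_def measure_def)
  then have "(E - (E - X)) \<union> (X - E) \<in> noise_field s t" using E by blast
  moreover have "(E - (E - X)) \<union> (X - E) = X" by blast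
  ultimately show ?thesis by simp
qed

lemma prob_Int_trivial:
  assumes "C \<in> events" "N \<in> events" "prob N = 0 \<or> prob N = 1"
  shows "prob (C \<inter> N) = prob C * prob N"
proof (cases "prob N = 0")
  case True
  then have "prob (C \<inter> N) \<le> 0" using finite_measure_mono[of "C \<inter> N" N] assms by simp
  then show ?thesis using True measure_nonneg[of W "C \<inter> N"] by simp
next
  case False
  then have "prob N = 1" using assms by simp
  then have "AE \<omega> in W. \<omega> \<in> N" using assms(2) by (simp add: prob_eq_1)
  then have "prob (C \<inter> N) = prob C"
    using assms by (intro measure_eq_AE) (auto elim: eventually_mono)
  then show ?thesis using \<open>prob N = 1\<close> by simp
qed

text \<open>The trivial events are intersected in because they belong to \<^const>\<open>increment_field\<close>; this keeps
  the generating system stable under intersection.\<close>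

definition cylinder_system :: "real set \<Rightarrow> (real \<Rightarrow> real) set set" where
  "cylinder_system R = {C \<inter> N | C N T. finite T \<and> T \<subseteq> R \<and> C \<in> cylinder_field T \<and>
     N \<in> events \<and> (prob N = 0 \<or> prob N = 1)}"

lemma cylinder_system_events: "R \<subseteq> {0..} \<Longrightarrow> cylinder_system R \<subseteq> events"
  unfolding cylinder_system_def using cylinder_field_events by blast

lemma Int_stable_cylinder_system: "Int_stable (cylinder_system R)"
  unfolding Int_stable_def
proof (intro ballI)
  fix X Y assume "X \<in> cylinder_system R" "Y \<in> cylinder_system R"
  then obtain C N T C' N' T' where
    X: "X = C \<inter> N" "finite T" "T \<subseteq> R" "C \<in> cylinder_field T" "N \<in> events" "prob N = 0 \<or> prob N = 1"
    and Y: "Y = C' \<inter> N'" "finite T'" "T' \<subseteq> R" "C' \<in> cylinder_field T'" "N' \<in> events"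
      "prob N' = 0 \<or> prob N' = 1"
    unfolding cylinder_system_def by blast
  have "C \<inter> C' \<in> cylinder_field (T \<union> T')"
    using X Y cylinder_field_mono[of T "T \<union> T'"] cylinder_field_mono[of T' "T \<union> T'"]
    by (intro cylinder_field_Int) auto
  moreover have "prob (N \<inter> N') = 0 \<or> prob (N \<inter> N') = 1"
    using prob_Int_trivial[OF X(5) Y(5,6)] X(6) Y(6) by auto
  moreover have "X \<inter> Y = (C \<inter> C') \<inter> (N \<inter> N')" using X Y by blast
  moreover have "finite (T \<union> T')" "T \<union> T' \<subseteq> R" "N \<inter> N' \<in> events" using X Y by auto
  ultimately show "X \<inter> Y \<in> cylinder_system R"
    unfolding cylinder_system_def by blast
qed

text \<open>Each generator involves at most two times: an increment event takes
  \<open>T = {u, v}\<close> and \<open>N = \<Omega>\<^sub>0\<close>, a trivial event takes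
  \<open>T = {}\<close> and \<open>C = \<Omega>\<^sub>0\<close>.\<close>

lemma noise_field_subset_cylinder_system:
  "noise_field s t \<subseteq> sigma_sets (space W) (cylinder_system {s..t})"
  unfolding noise_field_eq space_W
proof (rule sigma_sets_subseteq, rule Un_least)
  have top: "\<Omega>\<^sub>0 \<in> events" "prob \<Omega>\<^sub>0 = 1" using prob_space sets.top[of W] by (simp_all add: space_W)
  show "{{\<omega> \<in> \<Omega>\<^sub>0. \<omega> v - \<omega> u \<in> E} | u v E. s \<le> u \<and> u \<le> v \<and> v \<le> t \<and> E \<in> sets borel}
    \<subseteq> cylinder_system {s..t}"
  proof clarify
    fix u v :: real and E :: "real set"
    assume uv: "s \<le> u" "u \<le> v" "v \<le> t" "E \<in> sets borel"
    have eq: "{\<omega> \<in> \<Omega>\<^sub>0. \<omega> v - \<omega> u \<in> E} = ((\<lambda>\<omega>. \<omega> v - \<omega> u) -` E \<inter> \<Omega>\<^sub>0) \<inter> \<Omega>\<^sub>0" by auto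
    have "(\<lambda>\<omega>. \<omega> v - \<omega> u) -` E \<inter> \<Omega>\<^sub>0 \<in> cylinder_field {u, v}"
      unfolding cylinder_field_def using uv by (intro sigma_sets.Basic) blast
    moreover have "finite {u, v}" "{u, v} \<subseteq> {s..t}" using uv by auto
    ultimately show "{\<omega> \<in> \<Omega>\<^sub>0. \<omega> v - \<omega> u \<in> E} \<in> cylinder_system {s..t}"
      unfolding eq cylinder_system_def using top by blast
  qed
  show "{N \<in> events. emeasure W N = 0 \<or> emeasure W N = 1} \<subseteq> cylinder_system {s..t}"
  proof clarify
    fix N assume N: "N \<in> events" "emeasure W N = 0 \<or> emeasure W N = 1"
    have "\<Omega>\<^sub>0 \<in> cylinder_field {}" unfolding cylinder_field_def by (rule sigma_sets_top)
    moreover have "N = \<Omega>\<^sub>0 \<inter> N" using sets.sets_into_space[OF N(1)] by (auto simp: space_W)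
    moreover have "prob N = 0 \<or> prob N = 1" using N by (auto simp: measure_def)
    moreover have "finite {}" "{} \<subseteq> {s..t}" by auto
    ultimately show "N \<in> cylinder_system {s..t}"
      unfolding cylinder_system_def using N(1) by blast
  qed
qed

text \<open>Grids in \<open>{r..s}\<close> and \<open>{s..t}\<close> are separated by
  \<open>s\<close>, trivial events factor out of every probability, and intersection stability
  carries the product rule from the generators to the fields.\<close>

lemma indep_adjacent_noise:
  assumes r: "0 \<le> r" "r \<le> s"
    and C: "C \<in> noise_field r s" and D: "D \<in> noise_field s t"
  shows "prob (C \<inter> D) = prob C * prob D"
proof -
  have "indep_set (cylinder_system {r..s}) (cylinder_system {s..t})"
  proof (rule indep_setI)
    show "cylinder_system {r..s} \<subseteq> events" "cylinder_system {s..t} \<subseteq> events"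
      using r by (auto intro!: cylinder_system_events)
    fix X Y assume "X \<in> cylinder_system {r..s}" "Y \<in> cylinder_system {s..t}"
    then obtain C N T C' N' T' where
      X: "X = C \<inter> N" "finite T" "T \<subseteq> {r..s}" "C \<in> cylinder_field T" "N \<in> events"
        "prob N = 0 \<or> prob N = 1"
      and Y: "Y = C' \<inter> N'" "finite T'" "T' \<subseteq> {s..t}" "C' \<in> cylinder_field T'" "N' \<in> events"
        "prob N' = 0 \<or> prob N' = 1"
      unfolding cylinder_system_def by blast
    have "T \<subseteq> {0..}" "T' \<subseteq> {0..}" "T \<subseteq> {0..s}" "T' \<subseteq> {s..}" using X(3) Y(3) r by auto
    note sub = this
    then have ev: "C \<in> events" "C' \<in> events"
      using X(4) Y(4) cylinder_field_events by blast+
    have CC: "prob (C \<inter> C') = prob C * prob C'"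
      using sub X Y r by (intro indep_cylinder_fields[of T T' s]) auto
    have NN: "prob (N \<inter> N') = prob N * prob N'" using X Y by (intro prob_Int_trivial)
    have "X \<inter> Y = (C \<inter> C') \<inter> (N \<inter> N')" using X Y by blast
    also have "prob \<dots> = prob (C \<inter> C') * prob (N \<inter> N')"
      using X Y ev NN by (intro prob_Int_trivial) auto
    finally show "prob (X \<inter> Y) = prob X * prob Y"
      using X Y ev by (simp add: CC NN prob_Int_trivial)
  qed
  then have "indep_set (sigma_sets (space W) (cylinder_system {r..s}))
      (sigma_sets (space W) (cylinder_system {s..t}))"
    by (intro indep_set_sigma_sets Int_stable_cylinder_system)
  then show ?thesis
    using C D noise_field_subset_cylinder_system by (blast intro: indep_setD)
qed

text \<open>One induction proves the three claims, since the intersection of the first blocks must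
  be located in the field up to \<open>\<tau> n\<close> before independence of the next block
  applies. Intersecting with \<open>\<Omega>\<^sub>0\<close> makes the empty family yield the sure
  event rather than \<open>UNIV\<close>.\<close>

lemma prob_noise_blocks:
  assumes pos: "0 \<le> \<tau> 0" and step: "\<And>i. i < n \<Longrightarrow> \<tau> i \<le> \<tau> (Suc i)"
    and C: "\<And>i. i < n \<Longrightarrow> C i \<in> noise_field (\<tau> i) (\<tau> (Suc i))"
  shows "\<Omega>\<^sub>0 \<inter> (\<Inter>i<n. C i) \<in> noise_field (\<tau> 0) (\<tau> n)" (is ?A)
    and "prob (\<Omega>\<^sub>0 \<inter> (\<Inter>i<n. C i)) = (\<Prod>i<n. prob (C i))" (is ?B)
    and "\<tau> 0 \<le> \<tau> n" (is ?C)
proof -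
  have "?A \<and> ?B \<and> ?C" using step C
  proof (induction n)
    case 0
    have "\<Omega>\<^sub>0 \<in> noise_field (\<tau> 0) (\<tau> 0)" using sets.top[of "increment_field W (\<tau> 0) (\<tau> 0)"]
      by (simp add: space_increment_field)
    then show ?case using prob_space by (simp add: space_W)
  next
    case (Suc n)
    let ?X = "\<Omega>\<^sub>0 \<inter> (\<Inter>i<n. C i)"
    have IH: "?X \<in> noise_field (\<tau> 0) (\<tau> n)" "prob ?X = (\<Prod>i<n. prob (C i))" "\<tau> 0 \<le> \<tau> n"
      using Suc by auto
    have eq: "\<Omega>\<^sub>0 \<inter> (\<Inter>i<Suc n. C i) = ?X \<inter> C n" by (auto simp: less_Suc_eq)
    have le: "\<tau> n \<le> \<tau> (Suc n)" using Suc.prems by simp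
    have Cn: "C n \<in> noise_field (\<tau> n) (\<tau> (Suc n))" using Suc.prems by simp
    have "?X \<in> noise_field (\<tau> 0) (\<tau> (Suc n))" "C n \<in> noise_field (\<tau> 0) (\<tau> (Suc n))"
      using IH(1) Cn noise_field_mono[of "\<tau> 0" "\<tau> 0" "\<tau> n" "\<tau> (Suc n)"] le
        noise_field_mono[of "\<tau> 0" "\<tau> n" "\<tau> (Suc n)" "\<tau> (Suc n)"] IH(3) by auto
    then have "?X \<inter> C n \<in> noise_field (\<tau> 0) (\<tau> (Suc n))" by blast
    moreover have "prob (?X \<inter> C n) = prob ?X * prob (C n)"
      using pos IH Cn by (intro indep_adjacent_noise[of "\<tau> 0" "\<tau> n"]) auto
    ultimately show ?case unfolding eq using IH le by (simp add: mult.commute)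
  qed
  then show ?A ?B ?C by auto
qed

lemma indep_noise_blocks:
  assumes pos: "0 \<le> \<tau> 0" and step: "\<And>i. i < n \<Longrightarrow> \<tau> i \<le> \<tau> (Suc i)"
  shows "indep_sets (\<lambda>i. noise_field (\<tau> i) (\<tau> (Suc i))) {..<n::nat}"
proof (rule indep_setsI)
  show "noise_field (\<tau> i) (\<tau> (Suc i)) \<subseteq> events" for i by (rule noise_field_events)
  fix A J assume J: "J \<noteq> {}" "J \<subseteq> {..<n}" "finite J"
    and A: "\<forall>j\<in>J. A j \<in> noise_field (\<tau> j) (\<tau> (Suc j))"
  \<comment> \<open>Blocks outside \<open>J\<close> are filled with the sure event, which reduces a
    subfamily to the full row of adjacent blocks.\<close>
  define C where "C i = (if i \<in> J then A i else \<Omega>\<^sub>0)" for i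
  have top: "\<Omega>\<^sub>0 \<in> noise_field s t" for s t
    using sets.top[of "increment_field W (ereal s) (ereal t)"] by (simp add: space_increment_field)
  have AO: "A j \<subseteq> \<Omega>\<^sub>0" if "j \<in> J" for j
    using sets.sets_into_space[of "A j" "increment_field W (\<tau> j) (\<tau> (Suc j))"] A that
    by (simp add: space_increment_field)
  have "(\<Inter>j\<in>J. A j) = \<Omega>\<^sub>0 \<inter> (\<Inter>i<n. C i)"
    using J AO by (auto simp: C_def split: if_splits)
  also have "prob \<dots> = (\<Prod>i<n. prob (C i))"
    using A by (intro prob_noise_blocks(2)[where \<tau>=\<tau>] pos step) (auto simp: C_def top)
  also have "\<dots> = (\<Prod>i\<in>J. prob (C i))"
    using J prob_space by (intro prod.mono_neutral_right) (auto simp: C_def space_W)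
  also have "\<dots> = (\<Prod>i\<in>J. prob (A i))" by (simp add: C_def)
  finally show "prob (\<Inter>j\<in>J. A j) = (\<Prod>j\<in>J. prob (A j))" .
qed

end

section \<open>Miss events of a local stationary random set\<close>

locale stationary_random_set = wiener_noise +
  fixes M :: "(real \<Rightarrow> real) \<Rightarrow> real set"
  assumes countable_set: "random_countable_set W M"
    and local_set: "local_random_set W M"
    and stationary: "hit_or_miss_stationary W M"
begin

definition miss :: "real \<Rightarrow> real \<Rightarrow> (real \<Rightarrow> real) set" where
  "miss s t = {\<omega> \<in> \<Omega>\<^sub>0. M \<omega> \<inter> {s<..<t} = {}}"

text \<open>Up to a null event, missing the interval means that every term of a local enumeration
  sits in the coffin, a countable intersection of measurable conditions.\<close>

lemma miss_in_noise_field: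
  assumes "s < t"
  shows "miss s t \<in> noise_field s t"
proof -
  have "ereal s < ereal t" using assms by simp
  then obtain S where S: "measurable_enumeration W (increment_field W s t)
      (\<lambda>\<omega>. M \<omega> \<inter> {x. ereal s < ereal x \<and> ereal x < ereal t}) S"
    using local_set unfolding local_random_set_def by blast
  have None: "{None} \<in> sets coffin_borel"
    unfolding coffin_borel_def by (subst sets_measure_of) (auto intro: sigma_sets.Basic)
  have "S i -` {None} \<inter> space (increment_field W s t) \<in> noise_field s t" for i
    using S None by (intro measurable_sets[of _ _ coffin_borel]) (auto simp: measurable_enumeration_def)
  then have "(\<Inter>i. S i -` {None} \<inter> space (increment_field W s t)) \<in> noise_field s t"
    by (intro sets.countable_INT) auto
  then have "(\<Inter>i. S i -` {None} \<inter> \<Omega>\<^sub>0) \<in> noise_field s t" by (simp add: space_increment_field)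
  moreover have "miss s t \<subseteq> \<Omega>\<^sub>0" by (auto simp: miss_def)
  moreover have "AE \<omega> in W. \<omega> \<in> miss s t \<longleftrightarrow> \<omega> \<in> (\<Inter>i. S i -` {None} \<inter> \<Omega>\<^sub>0)"
  proof -
    have "AE \<omega> in W. M \<omega> \<inter> {x. ereal s < ereal x \<and> ereal x < ereal t} = enum_range (\<lambda>i. S i \<omega>)"
      using S by (simp add: measurable_enumeration_def)
    then show ?thesis
    proof eventually_elim
      case (elim \<omega>)
      have "{s<..<t} = {x. ereal s < ereal x \<and> ereal x < ereal t}" by auto
      then have "M \<omega> \<inter> {s<..<t} = enum_range (\<lambda>i. S i \<omega>)" using elim by simp
      moreover have "enum_range (\<lambda>i. S i \<omega>) = {} \<longleftrightarrow> (\<forall>i. S i \<omega> = None)"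
        by (rule enum_range_empty_iff)
      ultimately have "M \<omega> \<inter> {s<..<t} = {} \<longleftrightarrow> (\<forall>i. S i \<omega> = None)" by simp
      then show ?case unfolding miss_def by auto
    qed
  qed
  ultimately show ?thesis by (rule noise_field_AE_cong)
qed

lemma miss_events: "s < t \<Longrightarrow> miss s t \<in> events"
  using miss_in_noise_field noise_field_events by blast

lemma hit_or_miss_translate:
  assumes "E \<in> sets borel"
  shows "emeasure W {\<omega> \<in> space W. M \<omega> \<inter> ((+) x ` E) = {}} =
    emeasure W {\<omega> \<in> space W. M \<omega> \<inter> ((+) y ` E) = {}}"
proof -
  let ?A = "Pow (UNIV - E)"
  have A: "?A \<in> sets hit_or_miss_field"
    unfolding hit_or_miss_field_def using assms by (subst sets_measure_of) (auto intro: sigma_sets.Basic)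
  obtain c where c: "emeasure W {\<omega> \<in> space W. (\<lambda>y. z + y) ` M \<omega> \<in> ?A} = c" for z
    using bspec[OF stationary[unfolded hit_or_miss_stationary_def] A] unfolding constant_on_def by auto
  \<comment> \<open>Shifting \<open>M\<close> by \<open>- z\<close> against a fixed \<open>E\<close>
    amounts to holding \<open>M\<close> and shifting \<open>E\<close> by \<open>z\<close>; hence
    stationarity is applied at \<open>- x\<close> and \<open>- y\<close>.\<close>
  have eq: "(\<lambda>y. - z + y) ` S \<in> ?A \<longleftrightarrow> S \<inter> ((+) z ` E) = {}" for z S by force
  show ?thesis using c[of "- x"] c[of "- y"] by (simp only: eq)
qed

text \<open>\<open>x\<close> and \<open>y\<close> may be negative. Independence is developed for
  nonnegative times only, and this is the link to the rest of the line.\<close>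

lemma prob_miss_translate:
  assumes "0 < h"
  shows "prob (miss x (x + h)) = prob (miss y (y + h))"
proof -
  have "(+) x ` {0<..<h} = {x<..<x + h}" for x
  proof
    show "{x<..<x + h} \<subseteq> (+) x ` {0<..<h}"
    proof
      fix y assume "y \<in> {x<..<x + h}"
      then show "y \<in> (+) x ` {0<..<h}" by (intro image_eqI[of _ _ "y - x"]) auto
    qed
  qed auto
  then have "miss x (x + h) = {\<omega> \<in> space W. M \<omega> \<inter> ((+) x ` {0<..<h}) = {}}" for x
    by (simp add: miss_def space_W)
  then show ?thesis
    using hit_or_miss_translate[of "{0<..<h}" x y] by (simp add: measure_def)
qed

text \<open>The laws of the \<open>S i\<close> have countably many atoms, so some point \<open>y\<close> is avoided; stationarity
  carries this over to every point.\<close>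

lemma no_fixed_points: "AE \<omega> in W. x \<notin> M \<omega>"
proof -
  obtain S where S: "measurable_enumeration W W M S"
    using countable_set by (auto simp: random_countable_set_def)
  have Sm: "S i \<in> W \<rightarrow>\<^sub>M coffin_borel" for i
    using S by (simp add: measurable_enumeration_def)
  have sing: "{Some y} \<in> sets coffin_borel" for y
  proof -
    have "Some ` {y} \<in> sets coffin_borel"
      unfolding coffin_borel_def by (subst sets_measure_of) (auto intro!: sigma_sets.Basic)
    then show ?thesis by simp
  qed
  have "countable {z. measure (distr W coffin_borel (S i)) {z} \<noteq> 0}" for i
    by (intro finite_measure.countable_support prob_space.finite_measure prob_space_distr Sm)
  then have "countable (\<Union>i. {z. measure (distr W coffin_borel (S i)) {z} \<noteq> 0})" (is "countable ?D")
    by simp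
  \<comment> \<open>If \<open>None\<close> is an atom, \<open>the None\<close> is some unspecified
    real; that adds at most one point to the countable set to be avoided.\<close>
  then have "countable (the ` ?D)" by (rule countable_image)
  then have "the ` ?D \<noteq> UNIV" using uncountable_UNIV_real by metis
  then obtain y where y: "y \<notin> the ` ?D" by fast
  then have "Some y \<notin> ?D" using imageI[of "Some y" ?D the] by (simp only: option.sel) blast
  then have null: "measure (distr W coffin_borel (S i)) {Some y} = 0" for i by simp
  have "AE \<omega> in W. S i \<omega> \<noteq> Some y" for i
  proof -
    have "prob (S i -` {Some y} \<inter> space W) = 0"
      using null[of i] sing Sm by (simp add: measure_distr)
    moreover have "S i -` {Some y} \<inter> space W \<in> events" using sing Sm by (rule measurable_sets[rotated])
    ultimately have "AE \<omega> in W. \<omega> \<notin> S i -` {Some y} \<inter> space W"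
      by (simp add: prob_eq_0)
    with AE_space show ?thesis by eventually_elim auto
  qed
  then have "AE \<omega> in W. \<forall>i. S i \<omega> \<noteq> Some y" by (simp add: AE_all_countable)
  moreover have "AE \<omega> in W. M \<omega> = enum_range (\<lambda>i. S i \<omega>)"
    using S by (simp add: measurable_enumeration_def)
  ultimately have y: "AE \<omega> in W. y \<notin> M \<omega>"
  proof eventually_elim
    case (elim \<omega>)
    show ?case
    proof
      assume "y \<in> M \<omega>"
      then obtain i where "Some y = S i \<omega>" using elim(2) by (auto simp: enum_range_def)
      then show False using elim(1) by metis
    qed
  qed
  have eq: "{\<omega> \<in> space W. M \<omega> \<inter> ((+) z ` {0}) = {}} = {\<omega> \<in> space W. z \<notin> M \<omega>}" for z by auto
  have "emeasure W {\<omega> \<in> space W. x \<notin> M \<omega>} = emeasure W {\<omega> \<in> space W. y \<notin> M \<omega>}"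
    using hit_or_miss_translate[of "{0}" x y] unfolding eq by simp
  also have "\<dots> = 1"
  proof -
    \<comment> \<open>The event is not given as measurable; completeness supplies this through its
      negligible complement.\<close>
    have "space W - {\<omega> \<in> space W. y \<notin> M \<omega>} \<in> null_sets W"
      using y by (intro negligible_in_sets) (auto simp: space_W elim: eventually_mono)
    then have "space W - (space W - {\<omega> \<in> space W. y \<notin> M \<omega>}) \<in> events" by blast
    also have "space W - (space W - {\<omega> \<in> space W. y \<notin> M \<omega>}) = {\<omega> \<in> space W. y \<notin> M \<omega>}" by auto
    finally have "{\<omega> \<in> space W. y \<notin> M \<omega>} \<in> events" .
    then show ?thesis using y by (intro emeasure_eq_1_AE) (auto elim: eventually_mono)
  qed
  finally have one: "emeasure W {\<omega> \<in> space W. x \<notin> M \<omega>} = 1" .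
  \<comment> \<open>\<open>emeasure\<close> is 0 outside the sigma-field, so the value 1 already
    forces measurability.\<close>
  then have "{\<omega> \<in> space W. x \<notin> M \<omega>} \<in> events" by (metis emeasure_notin_sets zero_neq_one)
  then have "AE \<omega> in W. \<omega> \<in> {\<omega> \<in> space W. x \<notin> M \<omega>}"
    using one by (intro iffD1[OF prob_eq_1]) (auto simp: measure_def)
  then show ?thesis by eventually_elim simp
qed

text \<open>Missing all the open pieces differs from missing the whole interval only at the interior
  cut points, which almost surely do not belong to \<open>M\<close>.\<close>

lemma miss_subdivide:
  assumes "\<And>i. i < n \<Longrightarrow> \<tau> i < \<tau> (Suc i)" "0 < n"
  shows "AE \<omega> in W. \<omega> \<in> miss (\<tau> 0) (\<tau> n) \<longleftrightarrow> (\<forall>i<n. \<omega> \<in> miss (\<tau> i) (\<tau> (Suc i)))"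
proof -
  have "AE \<omega> in W. \<forall>i. \<tau> i \<notin> M \<omega>" using no_fixed_points by (simp add: AE_all_countable)
  then show ?thesis
  proof eventually_elim
    case (elim \<omega>)
    show ?case using assms(2,1)
    proof (induction n rule: nat_induct_non_zero)
      case 1
      then show ?case by simp
    next
      case (Suc n)
      have "\<tau> 0 < \<tau> n" "\<tau> n < \<tau> (Suc n)"
        using strict_steps_less[of n \<tau> 0 n] Suc.prems Suc.hyps by auto
      moreover have "\<tau> n \<notin> M \<omega>" using elim by simp
      ultimately have "M \<omega> \<inter> {\<tau> 0<..<\<tau> (Suc n)} = {} \<longleftrightarrow>
          M \<omega> \<inter> {\<tau> 0<..<\<tau> n} = {} \<and> M \<omega> \<inter> {\<tau> n<..<\<tau> (Suc n)} = {}"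
        by (auto simp: disjoint_iff) (metis linorder_neqE_linordered_idom less_trans)+
      then have "\<omega> \<in> miss (\<tau> 0) (\<tau> (Suc n)) \<longleftrightarrow> \<omega> \<in> miss (\<tau> 0) (\<tau> n) \<and> \<omega> \<in> miss (\<tau> n) (\<tau> (Suc n))"
        by (auto simp: miss_def)
      also have "\<dots> \<longleftrightarrow> (\<forall>i<Suc n. \<omega> \<in> miss (\<tau> i) (\<tau> (Suc i)))"
        using Suc by (auto simp: less_Suc_eq)
      finally show ?case .
    qed
  qed
qed

lemma prob_miss_subdivide:
  assumes pos: "0 \<le> \<tau> 0" and step: "\<And>i. i < n \<Longrightarrow> \<tau> i < \<tau> (Suc i)" and "0 < n"
  shows "prob (miss (\<tau> 0) (\<tau> n)) = (\<Prod>i<n. prob (miss (\<tau> i) (\<tau> (Suc i))))"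
proof -
  have "prob (miss (\<tau> 0) (\<tau> n)) = prob (\<Omega>\<^sub>0 \<inter> (\<Inter>i<n. miss (\<tau> i) (\<tau> (Suc i))))"
  proof (rule measure_eq_AE)
    have "AE \<omega> in W. \<omega> \<in> miss (\<tau> 0) (\<tau> n) \<longleftrightarrow> (\<forall>i<n. \<omega> \<in> miss (\<tau> i) (\<tau> (Suc i)))"
      using step \<open>0 < n\<close> by (rule miss_subdivide)
    then show "AE \<omega> in W. \<omega> \<in> miss (\<tau> 0) (\<tau> n) \<longleftrightarrow> \<omega> \<in> \<Omega>\<^sub>0 \<inter> (\<Inter>i<n. miss (\<tau> i) (\<tau> (Suc i)))"
      using AE_space
      by eventually_elim (auto simp: space_W)
    show "miss (\<tau> 0) (\<tau> n) \<in> events"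
      using strict_steps_less[of n \<tau> 0 n] assms by (intro miss_events) auto
    show "\<Omega>\<^sub>0 \<inter> (\<Inter>i<n. miss (\<tau> i) (\<tau> (Suc i))) \<in> events"
      using prob_noise_blocks(1)[of \<tau> n, OF pos _ miss_in_noise_field[OF step]] step
        noise_field_events by (auto intro: less_imp_le)
  qed
  also have "\<dots> = (\<Prod>i<n. prob (miss (\<tau> i) (\<tau> (Suc i))))"
    using step by (intro prob_noise_blocks(2)[where \<tau>=\<tau>] pos miss_in_noise_field) (auto intro: less_imp_le)
  finally show ?thesis .
qed

lemma prob_miss_power:
  assumes "0 \<le> s" "0 < h" "0 < n"
  shows "prob (miss s (s + real n * h)) = prob (miss 0 h) ^ n"
proof -
  let ?\<tau> = "\<lambda>i. s + real i * h"
  have "prob (miss (?\<tau> 0) (?\<tau> n)) = (\<Prod>i<n. prob (miss (?\<tau> i) (?\<tau> (Suc i))))"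
    using assms by (intro prob_miss_subdivide) (auto simp: algebra_simps)
  also have "\<dots> = (\<Prod>i<n. prob (miss 0 h))"
  proof (rule prod.cong[OF refl])
    fix i
    show "prob (miss (?\<tau> i) (?\<tau> (Suc i))) = prob (miss 0 h)"
      using prob_miss_translate[OF \<open>0 < h\<close>, of "?\<tau> i" 0] by (simp add: algebra_simps)
  qed
  finally show ?thesis by simp
qed

end

section \<open>Miss events and increments\<close>

lemma norm_iexp_minus_one_le: "cmod (iexp x - 1) \<le> \<bar>x\<bar>"
  using iexp_approx1[of x 0] by simp

text \<open>Truncation at level \<open>e\<close>: up to \<open>e\<close> the first term suffices and
  keeps the small factor \<open>d\<close>; beyond it \<open>d\<close> is given up, and
  \<open>\<bar>x\<bar>\<close> is at most \<open>x ^ 4 / e ^ 3\<close>, whose mean a moment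
  controls.\<close>

lemma abs_mult_le_fourth_power:
  fixes x e d :: real
  assumes "0 < e" "0 \<le> d" "d \<le> 1"
  shows "\<bar>x\<bar> * d \<le> e * d + x ^ 4 / e ^ 3"
proof (cases "\<bar>x\<bar> \<le> e")
  case True
  then have "\<bar>x\<bar> * d \<le> e * d" using assms by (intro mult_right_mono)
  moreover have "0 \<le> x ^ 4 / e ^ 3" using assms by simp
  ultimately show ?thesis by linarith
next
  case False
  then have "e ^ 3 \<le> \<bar>x\<bar> ^ 3" using assms by (intro power_mono) auto
  then have "\<bar>x\<bar> * e ^ 3 \<le> \<bar>x\<bar> * \<bar>x\<bar> ^ 3" by (intro mult_left_mono) auto
  also have "\<dots> = \<bar>x\<bar> ^ 4" by (simp add: power_numeral_reduce)
  also have "\<dots> = x ^ 4" by (simp add: power_even_abs)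
  finally have "\<bar>x\<bar> \<le> x ^ 4 / e ^ 3" using assms by (simp add: pos_le_divide_eq)
  moreover have "\<bar>x\<bar> * d \<le> \<bar>x\<bar> * 1" using assms by (intro mult_left_mono) auto
  moreover have "0 \<le> e * d" using assms by simp
  ultimately show ?thesis by linarith
qed

context prob_space
begin

lemma integrable_iexp_real:
  assumes "X \<in> borel_measurable M"
  shows "integrable M (\<lambda>\<omega>. iexp (\<theta> * X \<omega>))"
  using assms by (intro integrable_iexp) auto

lemma integrable_iexp_indicator:
  assumes "X \<in> borel_measurable M" "A \<in> events"
  shows "integrable M (\<lambda>\<omega>. iexp (\<theta> * X \<omega>) * of_real (indicator A \<omega>))"
proof (rule integrable_const_bound[where B=1])
  show "AE \<omega> in M. cmod (iexp (\<theta> * X \<omega>) * of_real (indicator A \<omega>)) \<le> 1"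
    by (auto simp: norm_mult indicator_def)
qed (use assms in measurable)

text \<open>The covariance is at most the mean of \<open>\<bar>\<theta> * X\<bar>\<close> times the
  deviation of the indicator of \<open>A\<close> from \<open>prob A\<close>. Truncation at level
  \<open>e\<close> splits this mean: the first term carries the small factor
  \<open>1 - prob A\<close>, the second the fourth moment.\<close>

lemma char_event_correlation_bound:
  assumes X: "X \<in> borel_measurable M" and A: "A \<in> events"
    and X4: "integrable M (\<lambda>\<omega>. X \<omega> ^ 4)" and e: "0 < e"
  shows "cmod (expectation (\<lambda>\<omega>. iexp (\<theta> * X \<omega>) * of_real (indicator A \<omega>))
      - prob A * expectation (\<lambda>\<omega>. iexp (\<theta> * X \<omega>)))
    \<le> \<bar>\<theta>\<bar> * (2 * (1 - prob A) * e + expectation (\<lambda>\<omega>. X \<omega> ^ 4) / e ^ 3)"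
proof -
  define q where "q = prob A"
  have q: "0 \<le> q" "q \<le> 1" by (auto simp: q_def)
  define I :: "'a \<Rightarrow> real" where "I = indicator A"
  have I01: "I \<omega> = 0 \<or> I \<omega> = 1" for \<omega> by (auto simp: I_def indicator_def)
  have Iint: "integrable M I" unfolding I_def using A by (intro integrable_real_indicator) (simp_all add: less_top[symmetric])
  have EI: "expectation I = q" using A by (simp add: I_def q_def)
  note i1 = integrable_iexp_real[OF X, of \<theta>]
  have i2: "integrable M (\<lambda>\<omega>. iexp (\<theta> * X \<omega>) * of_real (I \<omega>))"
    unfolding I_def by (rule integrable_iexp_indicator[OF X A])
  have i3: "integrable M (\<lambda>\<omega>. complex_of_real (I \<omega>))"
    using Iint by (rule integrable_of_real)
  \<comment> \<open>Replacing \<open>iexp\<close> by \<open>iexp - 1\<close> is free because \<open>I - q\<close> is centred.\<close>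
  define g where "g \<omega> = (iexp (\<theta> * X \<omega>) - 1) * of_real (I \<omega> - q)" for \<omega>
  have g_eq: "g \<omega> = (iexp (\<theta> * X \<omega>) * of_real (I \<omega>) - of_real q * iexp (\<theta> * X \<omega>))
      - (of_real (I \<omega>) - of_real q)" for \<omega>
    by (simp add: g_def algebra_simps)
  have gint: "integrable M g"
    unfolding g_eq using i1 i2 i3 by (intro Bochner_Integration.integrable_diff integrable_mult_right) auto
  have Eg: "expectation g = expectation (\<lambda>\<omega>. iexp (\<theta> * X \<omega>) * of_real (I \<omega>))
      - q * expectation (\<lambda>\<omega>. iexp (\<theta> * X \<omega>))"
    unfolding g_eq using i1 i2 i3
    by (simp add: Bochner_Integration.integral_diff EI prob_space)
  \<comment> \<open>As \<open>I\<close> takes only the values 0 and 1, this is the deviation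
    \<open>\<bar>I \<omega> - q\<bar>\<close> in a form affine in \<open>I\<close>, so that its mean
    can be read off.\<close>
  define d where "d \<omega> = (1 - q) * I \<omega> + q * (1 - I \<omega>)" for \<omega>
  have d: "0 \<le> d \<omega>" "d \<omega> \<le> 1" "\<bar>I \<omega> - q\<bar> = d \<omega>" for \<omega>
    using I01[of \<omega>] q by (auto simp: d_def)
  have dint: "integrable M d" unfolding d_def using Iint by auto
  have Ed: "expectation d = 2 * q * (1 - q)"
    unfolding d_def using Iint by (simp add: EI prob_space algebra_simps)
  define h where "h \<omega> = \<bar>\<theta>\<bar> * (e * d \<omega> + X \<omega> ^ 4 / e ^ 3)" for \<omega>
  have hint: "integrable M h" unfolding h_def using dint X4 by auto
  have "cmod (g \<omega>) \<le> h \<omega>" for \<omega>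
  proof -
    have "cmod (g \<omega>) = cmod (iexp (\<theta> * X \<omega>) - 1) * d \<omega>"
      unfolding g_def norm_mult norm_of_real d ..
    also have "\<dots> \<le> \<bar>\<theta> * X \<omega>\<bar> * d \<omega>"
      using d by (intro mult_right_mono norm_iexp_minus_one_le)
    also have "\<dots> = \<bar>\<theta>\<bar> * (\<bar>X \<omega>\<bar> * d \<omega>)" by (simp add: abs_mult)
    also have "\<dots> \<le> h \<omega>"
      unfolding h_def using d e by (intro mult_left_mono abs_mult_le_fourth_power) auto
    finally show ?thesis .
  qed
  then have "expectation (\<lambda>\<omega>. cmod (g \<omega>)) \<le> expectation h"
    using gint hint by (intro integral_mono) auto
  then have "cmod (expectation g) \<le> expectation h"
    using integral_norm_bound[of M g] by linarith
  also have "expectation h = \<bar>\<theta>\<bar> * (e * (2 * q * (1 - q)) + expectation (\<lambda>\<omega>. X \<omega> ^ 4) / e ^ 3)"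
    unfolding h_def using dint X4 by (simp add: Ed)
  also have "\<dots> \<le> \<bar>\<theta>\<bar> * (2 * (1 - q) * e + expectation (\<lambda>\<omega>. X \<omega> ^ 4) / e ^ 3)"
  proof -
    have "q * (1 - q) \<le> 1 * (1 - q)" using q by (intro mult_right_mono) auto
    then have "e * (q * (1 - q)) \<le> e * (1 - q)" using e by simp
    then show ?thesis by (intro mult_left_mono) (auto simp: algebra_simps)
  qed
  finally show ?thesis unfolding Eg by (simp add: I_def q_def)
qed

text \<open>By hypothesis, the law of \<open>X\<close> conditioned on \<open>A\<close> has the
  characteristic function of \<open>X\<close> itself; Levy's uniqueness theorem identifies the two
  laws.\<close>

lemma indep_event_if_char:
  assumes X: "X \<in> borel_measurable M" and A: "A \<in> events" "0 < prob A"
    and char: "\<And>\<theta>. expectation (\<lambda>\<omega>. iexp (\<theta> * X \<omega>) * of_real (indicator A \<omega>)) =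
      prob A * expectation (\<lambda>\<omega>. iexp (\<theta> * X \<omega>))"
    and E: "E \<in> sets borel"
  shows "prob (A \<inter> (X -` E \<inter> space M)) = prob A * prob (X -` E \<inter> space M)"
proof -
  define p where "p = prob A"
  have p: "0 < p" using A by (simp add: p_def)
  have pos: "emeasure M A \<noteq> 0" "emeasure M A \<noteq> \<infinity>"
    using p by (auto simp: emeasure_eq_measure p_def)
  have dens: "uniform_measure M A = density M (\<lambda>\<omega>. ennreal (indicator A \<omega> / p))"
  proof -
    have "indicator A \<omega> / emeasure M A = ennreal (indicator A \<omega> / p)" for \<omega>
      using p divide_ennreal[of 1 p] by (auto simp: indicator_def emeasure_eq_measure p_def)
    then show ?thesis unfolding uniform_measure_def by simp
  qed
  interpret U: prob_space "uniform_measure M A" by (rule prob_space_uniform_measure[OF pos])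
  have XU: "X \<in> borel_measurable (uniform_measure M A)"
    using X by (simp add: uniform_measure_def)
  have "distr (uniform_measure M A) borel X = distr M borel X"
  proof (rule Levy_uniqueness)
    show "real_distribution (distr (uniform_measure M A) borel X)" using XU by (rule U.real_distribution_distr)
    show "real_distribution (distr M borel X)" using X by (rule real_distribution_distr)
    show "char (distr (uniform_measure M A) borel X) = char (distr M borel X)"
    proof
      fix \<theta>
      have m: "(\<lambda>x. iexp (\<theta> * x)) \<in> borel_measurable borel" by measurable
      have "char (distr (uniform_measure M A) borel X) \<theta> = (CLINT \<omega>|uniform_measure M A. iexp (\<theta> * X \<omega>))"
        unfolding char_def by (rule integral_distr[OF XU m])
      also have "\<dots> = (CLINT \<omega>|M. (indicator A \<omega> / p) *\<^sub>R iexp (\<theta> * X \<omega>))"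
        unfolding dens using X A p by (intro integral_density) auto
      also have "\<dots> = (CLINT \<omega>|M. (1 / of_real p) * (iexp (\<theta> * X \<omega>) * of_real (indicator A \<omega>)))"
        by (intro Bochner_Integration.integral_cong) (auto simp: scaleR_conv_of_real)
      also have "\<dots> = (1 / of_real p) * (CLINT \<omega>|M. iexp (\<theta> * X \<omega>) * of_real (indicator A \<omega>))"
        by simp
      also have "\<dots> = expectation (\<lambda>\<omega>. iexp (\<theta> * X \<omega>))"
        unfolding char using p by (simp add: p_def)
      also have "\<dots> = char (distr M borel X) \<theta>"
        unfolding char_def by (rule integral_distr[OF X m, symmetric])
      finally show "char (distr (uniform_measure M A) borel X) \<theta> = char (distr M borel X) \<theta>" .
    qed
  qed
  then have "measure (distr (uniform_measure M A) borel X) E = measure (distr M borel X) E" by simp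
  then have "measure (uniform_measure M A) (X -` E \<inter> space M) = prob (X -` E \<inter> space M)"
    using measure_distr[OF XU E] measure_distr[OF X E] by simp
  moreover have "X -` E \<inter> space M \<in> events" using X E by (rule measurable_sets)
  ultimately have "prob (A \<inter> (X -` E \<inter> space M)) / prob A = prob (X -` E \<inter> space M)"
    using measure_uniform_measure[OF pos] by simp
  then show ?thesis using A by (simp add: field_simps)
qed

end

lemma (in wiener_noise) indep_vars_noise_blocks:
  assumes "0 \<le> \<tau> 0" "\<And>i. i < n \<Longrightarrow> \<tau> i \<le> \<tau> (Suc i)"
    and Z: "\<And>i. i < n \<Longrightarrow> Z i \<in> increment_field W (ereal (\<tau> i)) (ereal (\<tau> (Suc i))) \<rightarrow>\<^sub>M N"
  shows "indep_vars (\<lambda>_. N) Z {..<n::nat}"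
  unfolding indep_vars_def2
proof (intro conjI ballI)
  show "Z i \<in> W \<rightarrow>\<^sub>M N" if "i \<in> {..<n}" for i
    using that by (intro measurable_from_subalg[OF subalgebra_increment_field[OF completed] Z]) simp
  show "indep_sets (\<lambda>i. {Z i -` A \<inter> space W |A. A \<in> sets N}) {..<n}"
  proof (rule indep_sets_mono_sets[OF indep_noise_blocks[of \<tau> n]], goal_cases)
    case (3 i)
    show ?case
    proof clarify
      fix A assume "A \<in> sets N"
      then show "Z i -` A \<inter> space W \<in> noise_field (\<tau> i) (\<tau> (Suc i))"
        using measurable_sets[OF Z[of i], of A] 3 by (simp add: space_increment_field space_W)
    qed
  qed (use assms in auto)
qed

section \<open>Subdivision into many short pieces\<close>

context stationary_random_set
begin

text \<open>Cut the interval into \<open>n\<close> equal pieces. The expectations with and without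
  the miss event both become products over the pieces, and the correlation estimate compares them
  factor by factor.\<close>

lemma char_increment_miss_bound:
  assumes st: "0 \<le> s" "s < t" and pos: "0 < prob (miss s t)" and n: "0 < (n::nat)" and e: "0 < e"
  shows "cmod (expectation (\<lambda>\<omega>. iexp (\<theta> * (\<omega> t - \<omega> s)) * of_real (indicator (miss s t) \<omega>))
      - prob (miss s t) * expectation (\<lambda>\<omega>. iexp (\<theta> * (\<omega> t - \<omega> s))))
    \<le> \<bar>\<theta>\<bar> * (- 2 * ln (prob (miss s t)) * e + 3 * (t - s)\<^sup>2 / (n * e ^ 3))"
proof -
  define h where "h = (t - s) / n"
  have h: "0 < h" using st n by (simp add: h_def)
  define \<tau> where "\<tau> i = s + real i * h" for i
  have \<tau>0: "\<tau> 0 = s" by (simp add: \<tau>_def)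
  have \<tau>n: "\<tau> n = t" using n by (simp add: \<tau>_def h_def)
  have \<tau>S: "\<tau> (Suc i) = \<tau> i + h" for i by (simp add: \<tau>_def algebra_simps)
  have \<tau>pos: "0 \<le> \<tau> i" for i using st h by (simp add: \<tau>_def)
  have step: "\<tau> i < \<tau> (Suc i)" for i using h by (simp add: \<tau>S)
  define q where "q = prob (miss 0 h)"
  define p where "p = prob (miss s t)"
  have pq: "p = q ^ n"
    using prob_miss_power[OF st(1) h n] \<tau>n by (simp add: p_def q_def \<tau>_def)
  have q01: "0 \<le> q" "q \<le> 1" by (simp_all add: q_def)
  \<comment> \<open>Since \<open>q\<close> is positive, \<open>ln q \<le> q - 1\<close> is
    available; it bounds \<open>n * (1 - q)\<close> by \<open>- ln p\<close>, independently of
    \<open>n\<close>.\<close>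
  have "0 < q" using pos pq q01 n unfolding p_def[symmetric] by (metis less_le zero_power)
  then have "ln p = n * ln q" by (simp add: pq ln_realpow)
  also have "\<dots> \<le> n * (q - 1)" using ln_le_minus_one[OF \<open>0 < q\<close>] by (intro mult_left_mono) auto
  finally have nq: "n * (1 - q) \<le> - ln p" by (simp add: algebra_simps)
  have qi: "prob (miss (\<tau> i) (\<tau> (Suc i))) = q" for i
    using prob_miss_translate[OF h, of "\<tau> i" 0] by (simp add: \<tau>S q_def)
  define \<Delta> where "\<Delta> i \<omega> = \<omega> (\<tau> (Suc i)) - \<omega> (\<tau> i)" for i and \<omega> :: "real \<Rightarrow> real"
  define Y where "Y i \<omega> = iexp (\<theta> * \<Delta> i \<omega>)" for i \<omega>
  define Z where "Z i \<omega> = iexp (\<theta> * \<Delta> i \<omega>) * of_real (indicator (miss (\<tau> i) (\<tau> (Suc i))) \<omega>)" for i \<omega>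
  have \<Delta>F: "\<Delta> i \<in> borel_measurable (increment_field W (\<tau> i) (\<tau> (Suc i)))" for i
    unfolding \<Delta>_def using step[of i] by (intro increment_in_noise_field) auto
  have \<Delta>W: "\<Delta> i \<in> borel_measurable W" for i
    unfolding \<Delta>_def by (intro increment_measurable \<tau>pos)
  have mF: "miss (\<tau> i) (\<tau> (Suc i)) \<in> noise_field (\<tau> i) (\<tau> (Suc i))" for i
    by (rule miss_in_noise_field[OF step])
  have mW: "miss (\<tau> i) (\<tau> (Suc i)) \<in> events" for i by (rule miss_events[OF step])
  have Yint: "integrable W (Y i)" for i unfolding Y_def by (rule integrable_iexp_real[OF \<Delta>W])
  have Zint: "integrable W (Z i)" for i unfolding Z_def by (rule integrable_iexp_indicator[OF \<Delta>W mW])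
  have YF: "Y i \<in> borel_measurable (increment_field W (\<tau> i) (\<tau> (Suc i)))" for i
    unfolding Y_def using \<Delta>F[of i] by measurable
  have ZF: "Z i \<in> borel_measurable (increment_field W (\<tau> i) (\<tau> (Suc i)))" for i
    unfolding Z_def using \<Delta>F[of i] mF[of i] by measurable
  have EY: "expectation (\<lambda>\<omega>. \<Prod>i<n. Y i \<omega>) = (\<Prod>i<n. expectation (Y i))"
    by (intro indep_vars_lebesgue_integral indep_vars_noise_blocks[where \<tau>=\<tau>] \<tau>pos YF Yint less_imp_le[OF step]) auto
  have EZ: "expectation (\<lambda>\<omega>. \<Prod>i<n. Z i \<omega>) = (\<Prod>i<n. expectation (Z i))"
    by (intro indep_vars_lebesgue_integral indep_vars_noise_blocks[where \<tau>=\<tau>] \<tau>pos ZF Zint less_imp_le[OF step]) auto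
  have prodY: "(\<Prod>i<n. Y i \<omega>) = iexp (\<theta> * (\<omega> t - \<omega> s))" for \<omega>
  proof -
    have "(\<Sum>i<n. \<Delta> i \<omega>) = \<omega> t - \<omega> s"
      unfolding \<Delta>_def using sum_lessThan_telescope[of "\<lambda>i. \<omega> (\<tau> i)" n] by (simp add: \<tau>0 \<tau>n)
    moreover have "(\<Prod>i<n. Y i \<omega>) = exp (\<Sum>i<n. \<i> * of_real (\<theta> * \<Delta> i \<omega>))"
      unfolding Y_def by (simp add: exp_sum)
    ultimately show ?thesis by (simp add: sum_distrib_left[symmetric] of_real_sum[symmetric] del: of_real_sum of_real_mult)
  qed
  have prodZ: "AE \<omega> in W. (\<Prod>i<n. Z i \<omega>) = iexp (\<theta> * (\<omega> t - \<omega> s)) * of_real (indicator (miss s t) \<omega>)"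
  proof -
    have "AE \<omega> in W. \<omega> \<in> miss (\<tau> 0) (\<tau> n) \<longleftrightarrow> (\<forall>i<n. \<omega> \<in> miss (\<tau> i) (\<tau> (Suc i)))"
      using step n by (rule miss_subdivide)
    then show ?thesis
    proof eventually_elim
      case (elim \<omega>)
      have "(\<Prod>i<n. complex_of_real (indicator (miss (\<tau> i) (\<tau> (Suc i))) \<omega>)) = of_real (indicator (miss s t) \<omega>)"
      proof (cases "\<omega> \<in> miss s t")
        case True
        then show ?thesis using elim by (simp add: \<tau>0 \<tau>n)
      next
        case False
        then obtain i where "i < n" "\<omega> \<notin> miss (\<tau> i) (\<tau> (Suc i))" using elim by (auto simp: \<tau>0 \<tau>n)
        then have "(\<Prod>i<n. complex_of_real (indicator (miss (\<tau> i) (\<tau> (Suc i))) \<omega>)) = 0"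
          by (intro prod_zero bexI[of _ i]) auto
        then show ?thesis using False by simp
      qed
      then show ?case
        unfolding prodY[symmetric] by (simp add: Z_def Y_def prod.distrib)
    qed
  qed
  have "expectation (\<lambda>\<omega>. iexp (\<theta> * (\<omega> t - \<omega> s)) * of_real (indicator (miss s t) \<omega>))
      = expectation (\<lambda>\<omega>. \<Prod>i<n. Z i \<omega>)"
  proof (rule integral_cong_AE)
    show "(\<lambda>\<omega>. iexp (\<theta> * (\<omega> t - \<omega> s)) * complex_of_real (indicator (miss s t) \<omega>)) \<in> borel_measurable W"
      using st by (intro borel_measurable_integrable integrable_iexp_indicator increment_measurable miss_events) auto
    show "(\<lambda>\<omega>. \<Prod>i<n. Z i \<omega>) \<in> borel_measurable W"
      by (intro borel_measurable_prod borel_measurable_integrable Zint)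
  qed (use prodZ in \<open>auto elim: eventually_mono\<close>)
  note eqZ = this[unfolded EZ]
  have "cmod (expectation (\<lambda>\<omega>. iexp (\<theta> * (\<omega> t - \<omega> s)) * of_real (indicator (miss s t) \<omega>))
      - p * expectation (\<lambda>\<omega>. iexp (\<theta> * (\<omega> t - \<omega> s))))
    = cmod ((\<Prod>i<n. expectation (Z i)) - (\<Prod>i<n. of_real q * expectation (Y i)))"
    unfolding eqZ EY[unfolded prodY] by (simp add: prod.distrib pq)
  \<comment> \<open>All factors lie in the closed unit disc, so the two products differ by at most
    the sum of the differences of their factors.\<close>
  also have "\<dots> \<le> (\<Sum>i<n. cmod (expectation (Z i) - of_real q * expectation (Y i)))"
  proof (rule norm_prod_diff)
    fix i
    have "cmod (expectation (Z i)) \<le> expectation (\<lambda>\<omega>. cmod (Z i \<omega>))" by (rule integral_norm_bound)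
    also have "\<dots> \<le> expectation (\<lambda>_. 1)"
    proof (rule integral_mono)
      show "cmod (Z i \<omega>) \<le> 1" for \<omega> by (simp add: Z_def norm_mult indicator_def)
    qed (use Zint[of i] in \<open>auto intro: integrable_norm\<close>)
    finally show "cmod (expectation (Z i)) \<le> 1" using prob_space by simp
    have "cmod (expectation (Y i)) \<le> expectation (\<lambda>\<omega>. cmod (Y i \<omega>))" by (rule integral_norm_bound)
    also have "\<dots> = 1" using prob_space by (simp add: Y_def)
    finally show "cmod (of_real q * expectation (Y i)) \<le> 1"
      using q01 by (simp add: norm_mult mult_le_one)
  qed
  also have "\<dots> \<le> (\<Sum>i<n. \<bar>\<theta>\<bar> * (2 * (1 - q) * e + 3 * h\<^sup>2 / e ^ 3))"
  proof (rule sum_mono)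
    fix i
    note m = increment_fourth_moment[OF \<tau>pos[of i] step[of i], folded \<Delta>_def]
    show "cmod (expectation (Z i) - of_real q * expectation (Y i))
        \<le> \<bar>\<theta>\<bar> * (2 * (1 - q) * e + 3 * h\<^sup>2 / e ^ 3)"
      using char_event_correlation_bound[OF \<Delta>W[of i] mW[of i] m(1) e, of \<theta>]
      unfolding m(2) qi Z_def Y_def by (simp add: \<tau>S)
  qed
  also have "\<dots> = \<bar>\<theta>\<bar> * (2 * (n * (1 - q)) * e + 3 * (n * h\<^sup>2) / e ^ 3)"
    by (simp add: algebra_simps)
  also have "\<dots> \<le> \<bar>\<theta>\<bar> * (2 * (- ln p) * e + 3 * (n * h\<^sup>2) / e ^ 3)"
    using nq e by (intro mult_left_mono add_right_mono mult_right_mono) auto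
  \<comment> \<open>This is the gain from the fourth moment: the contributions of the
    \<open>n\<close> pieces sum to order \<open>1 / n\<close>.\<close>
  also have "real n * h\<^sup>2 = (t - s)\<^sup>2 / n"
    using n by (simp add: h_def power2_eq_square field_simps)
  finally show ?thesis by (simp add: p_def)
qed

text \<open>In the preceding estimate \<open>n\<close> and \<open>e\<close> occur only in the bound,
  so \<open>e\<close> may tend to 0 while \<open>n * e ^ 3\<close> tends to infinity.\<close>

lemma char_increment_miss:
  assumes st: "0 \<le> s" "s < t" and pos: "0 < prob (miss s t)"
  shows "expectation (\<lambda>\<omega>. iexp (\<theta> * (\<omega> t - \<omega> s)) * of_real (indicator (miss s t) \<omega>))
      = prob (miss s t) * expectation (\<lambda>\<omega>. iexp (\<theta> * (\<omega> t - \<omega> s)))" (is "?a = ?b")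
proof -
  define K where "K = \<bar>\<theta>\<bar> * (- 2 * ln (prob (miss s t)) + 3 * (t - s)\<^sup>2)"
  have "cmod (?a - ?b) \<le> K / real (Suc k)" for k
  proof -
    define r where "r = real (Suc k)"
    have r: "0 < r" by (simp add: r_def)
    \<comment> \<open>Taking \<open>n = r^4\<close> pieces and \<open>e = 1 / r\<close> makes both error terms \<open>O(1 / r)\<close>.\<close>
    have "real (Suc k ^ 4) * (1 / r) ^ 3 = r ^ 4 * (1 / r) ^ 3" by (simp add: r_def)
    also have "\<dots> = r" using r by (simp add: power_divide power3_eq_cube power4_eq_xxxx)
    finally have eq: "real (Suc k ^ 4) * (1 / r) ^ 3 = r" .
    have "cmod (?a - ?b) \<le> \<bar>\<theta>\<bar> * (- 2 * ln (prob (miss s t)) * (1 / r) + 3 * (t - s)\<^sup>2 / r)"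
      using char_increment_miss_bound[OF st pos, of "Suc k ^ 4" "1 / r" \<theta>] r unfolding eq by simp
    also have "\<dots> = K / r" using r by (simp add: K_def field_simps)
    finally show ?thesis by (simp add: r_def)
  qed
  moreover have "(\<lambda>k. K / real (Suc k)) \<longlonglongrightarrow> 0"
    using tendsto_mult[OF tendsto_const LIMSEQ_inverse_real_of_nat, of K] by (simp add: field_simps)
  ultimately have "cmod (?a - ?b) \<le> 0"
    by (intro LIMSEQ_le_const[where X="\<lambda>k. K / real (Suc k)"]) auto
  then show ?thesis by simp
qed

lemma indep_miss_increment:
  assumes st: "0 \<le> s" "s < t" and pos: "0 < prob (miss s t)" and E: "E \<in> sets borel"
  shows "prob (miss s t \<inter> ((\<lambda>\<omega>. \<omega> t - \<omega> s) -` E \<inter> \<Omega>\<^sub>0))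
    = prob (miss s t) * prob ((\<lambda>\<omega>. \<omega> t - \<omega> s) -` E \<inter> \<Omega>\<^sub>0)"
proof -
  have "prob (miss s t \<inter> ((\<lambda>\<omega>. \<omega> t - \<omega> s) -` E \<inter> space W))
    = prob (miss s t) * prob ((\<lambda>\<omega>. \<omega> t - \<omega> s) -` E \<inter> space W)"
    using st by (intro indep_event_if_char increment_measurable miss_events char_increment_miss pos E) auto
  then show ?thesis by (simp only: space_W)
qed

end

section \<open>The zero-one law for miss events\<close>

context stationary_random_set
begin

lemma prob_miss_mono:
  assumes "s < t" "s' \<le> s" "t \<le> t'"
  shows "prob (miss s' t') \<le> prob (miss s t)"
  using assms by (intro finite_measure_mono miss_events) (auto simp: miss_def disjoint_iff)

text \<open>On a grid made of 0, 1 and \<open>T\<close>, the miss event splits into the miss events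
  of the pieces. Each of these is independent of the increment over its own piece, and distinct
  pieces are independent, so the product rule holds for rectangles in the increments and extends to
  what they generate.\<close>

lemma indep_miss_cylinder:
  assumes pos: "0 < prob (miss 0 1)" and T: "finite T" "T \<subseteq> {0..1}" and C: "C \<in> cylinder_field T"
  shows "prob (miss 0 1 \<inter> C) = prob (miss 0 1) * prob C"
proof -
  have "finite (insert 0 (insert 1 T))" using T by simp
  then obtain n \<tau> where \<tau>: "insert 0 (insert 1 T) = \<tau> ` {..n::nat}"
    and step: "\<And>i. i < n \<Longrightarrow> \<tau> i < \<tau> (Suc i)"
    by (rule finite_set_strict_enumeration) auto
  note less = strict_steps_less[of n \<tau>, OF step]
  have range: "\<tau> i \<in> {0..1}" if "i \<le> n" for i
  proof -
    have "\<tau> i \<in> insert 0 (insert 1 T)" using \<tau> that by auto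
    then show ?thesis using T by auto
  qed
  obtain i0 where i0: "i0 \<le> n" "\<tau> i0 = 0"
    using \<tau> by (metis atMost_iff imageE insertI1)
  obtain i1 where i1: "i1 \<le> n" "\<tau> i1 = 1"
    using \<tau> by (metis atMost_iff imageE insertI1 insertI2)
  have \<tau>0: "\<tau> 0 = 0" using less[of 0 i0] range[of 0] i0 by (cases "i0 = 0") auto
  have \<tau>n: "\<tau> n = 1" using less[of i1 n] range[of n] i1 by (cases "i1 = n") auto
  have n: "0 < n" using \<tau>0 \<tau>n by (cases n) auto
  define X where "X i B = (\<lambda>\<omega>. \<omega> (\<tau> (Suc i)) - \<omega> (\<tau> i)) -` B \<inter> \<Omega>\<^sub>0" for i and B :: "real set"
  define m where "m i = miss (\<tau> i) (\<tau> (Suc i))" for i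
  have XF: "X i B \<in> noise_field (\<tau> i) (\<tau> (Suc i))" if "i < n" "B \<in> sets borel" for i B
    using measurable_sets[OF increment_in_noise_field[of "\<tau> i" "\<tau> i" "\<tau> (Suc i)" "\<tau> (Suc i)"] that(2)]
      step[OF that(1)] by (simp add: X_def space_increment_field)
  have mF: "m i \<in> noise_field (\<tau> i) (\<tau> (Suc i))" if "i < n" for i
    unfolding m_def by (rule miss_in_noise_field[OF step[OF that]])
  note blocks = prob_noise_blocks[of \<tau> n, OF _ less_imp_le[OF step]]
  \<comment> \<open>Rectangles in the \<open>n\<close> increments: one Borel set for each index
    makes the system stable under intersection, and \<open>UNIV\<close> at the other indices
    recovers a condition on a single increment.\<close>
  define Q where "Q = {\<Omega>\<^sub>0 \<inter> (\<Inter>i<n. X i (B i)) | B. \<forall>i. B i \<in> sets borel}"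
  have Qev: "Q \<subseteq> events"
  proof
    fix D assume "D \<in> Q"
    then obtain B where "D = \<Omega>\<^sub>0 \<inter> (\<Inter>i<n. X i (B i))" "\<forall>i. B i \<in> sets borel"
      by (auto simp: Q_def)
    then have "D \<in> noise_field (\<tau> 0) (\<tau> n)"
      using blocks(1)[of "\<lambda>i. X i (B i)"] XF \<tau>0 by simp
    then show "D \<in> events" using noise_field_events by blast
  qed
  have mev: "miss 0 1 \<in> events" by (intro miss_events) simp
  have "indep_set {miss 0 1} Q"
  proof (rule indep_setI)
    fix a D assume a: "a \<in> {miss 0 1}" and D: "D \<in> Q"
    obtain B where D_eq: "D = \<Omega>\<^sub>0 \<inter> (\<Inter>i<n. X i (B i))" and B: "\<forall>i. B i \<in> sets borel"
      using D by (auto simp: Q_def)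
    have mX: "m i \<inter> X i (B i) \<in> noise_field (\<tau> i) (\<tau> (Suc i))" if "i < n" for i
      using mF[OF that] XF[OF that] B by auto
    have "prob (miss 0 1 \<inter> D) = prob (\<Omega>\<^sub>0 \<inter> (\<Inter>i<n. m i \<inter> X i (B i)))"
    proof (rule measure_eq_AE)
      have "AE \<omega> in W. \<omega> \<in> miss (\<tau> 0) (\<tau> n) \<longleftrightarrow> (\<forall>i<n. \<omega> \<in> miss (\<tau> i) (\<tau> (Suc i)))"
        using step n by (rule miss_subdivide)
      then show "AE \<omega> in W. \<omega> \<in> miss 0 1 \<inter> D \<longleftrightarrow> \<omega> \<in> \<Omega>\<^sub>0 \<inter> (\<Inter>i<n. m i \<inter> X i (B i))"
        by eventually_elim (auto simp: \<tau>0 \<tau>n D_eq m_def)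
      show "miss 0 1 \<inter> D \<in> events" using mev Qev D by auto
      show "\<Omega>\<^sub>0 \<inter> (\<Inter>i<n. m i \<inter> X i (B i)) \<in> events"
        using blocks(1)[of "\<lambda>i. m i \<inter> X i (B i)"] mX \<tau>0 noise_field_events by auto
    qed
    also have "\<dots> = (\<Prod>i<n. prob (m i \<inter> X i (B i)))"
      using mX \<tau>0 by (intro blocks(2)) auto
    also have "\<dots> = (\<Prod>i<n. prob (m i) * prob (X i (B i)))"
    proof (rule prod.cong[OF refl])
      fix i assume "i \<in> {..<n}"
      then have i: "i < n" by simp
      \<comment> \<open>Independence on a piece comes from conditioning on its miss event, which has
        positive probability because a shorter interval is easier to miss.\<close>
      have "0 < prob (m i)"
        using prob_miss_mono[OF step[OF i], of 0 1] range[of i] range[of "Suc i"] i pos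
        by (simp add: m_def)
      then show "prob (m i \<inter> X i (B i)) = prob (m i) * prob (X i (B i))"
        unfolding m_def X_def using range[of i] i step[OF i] B
        by (intro indep_miss_increment) auto
    qed
    also have "\<dots> = (\<Prod>i<n. prob (m i)) * (\<Prod>i<n. prob (X i (B i)))" by (rule prod.distrib)
    also have "(\<Prod>i<n. prob (m i)) = prob (miss 0 1)"
      using prob_miss_subdivide[of \<tau> n, OF _ step n] by (simp add: m_def \<tau>0 \<tau>n)
    also have "(\<Prod>i<n. prob (X i (B i))) = prob D"
      unfolding D_eq using XF B \<tau>0 by (intro blocks(2)[symmetric]) auto
    finally show "prob (a \<inter> D) = prob a * prob D" using a by simp
  qed (use mev Qev in auto)
  moreover have "Int_stable Q"
    unfolding Int_stable_def
  proof (intro ballI)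
    fix D D' assume "D \<in> Q" "D' \<in> Q"
    then obtain B B' where D: "D = \<Omega>\<^sub>0 \<inter> (\<Inter>i<n. X i (B i))" "\<forall>i. B i \<in> sets borel"
      and D': "D' = \<Omega>\<^sub>0 \<inter> (\<Inter>i<n. X i (B' i))" "\<forall>i. B' i \<in> sets borel"
      by (auto simp: Q_def)
    have "D \<inter> D' = \<Omega>\<^sub>0 \<inter> (\<Inter>i<n. X i (B i \<inter> B' i))" unfolding D D' by (auto simp: X_def)
    moreover have "\<forall>i. B i \<inter> B' i \<in> sets borel" using D D' by auto
    ultimately show "D \<inter> D' \<in> Q"
      unfolding Q_def mem_Collect_eq by (intro exI[of _ "\<lambda>i. B i \<inter> B' i"] conjI)
  qed
  moreover have "Int_stable {miss 0 1}" by (simp add: Int_stable_def)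
  ultimately have ind: "indep_set (sigma_sets (space W) {miss 0 1}) (sigma_sets (space W) Q)"
    by (intro indep_set_sigma_sets)
  have "T \<subseteq> \<tau> ` {0..n}" using \<tau> by (auto simp: atMost_atLeast0)
  then have "C \<in> cylinder_field (\<tau> ` {0..n})" using C by (rule subsetD[OF cylinder_field_mono])
  then have "C \<in> sigma_sets \<Omega>\<^sub>0 (\<Union>i\<in>{0..<n}. {X i B | B. B \<in> sets borel})"
    unfolding X_def by (rule subsetD[OF cylinder_field_image_subset])
  moreover have "(\<Union>i\<in>{0..<n}. {X i B | B. B \<in> sets borel}) \<subseteq> Q"
  proof clarify
    fix i and B :: "real set" assume i: "i \<in> {0..<n}" and B: "B \<in> sets borel"
    have "X i B = \<Omega>\<^sub>0 \<inter> (\<Inter>j<n. X j (if j = i then B else UNIV))"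
      using i by (auto simp: X_def)
    moreover have "\<forall>j. (if j = i then B else UNIV) \<in> sets borel" using B by simp
    ultimately show "X i B \<in> Q"
      unfolding Q_def mem_Collect_eq by (intro exI[of _ "\<lambda>j. if j = i then B else UNIV"] conjI)
  qed
  ultimately have "C \<in> sigma_sets (space W) Q"
    unfolding space_W by (rule subsetD[OF sigma_sets_subseteq, rotated])
  then show ?thesis by (intro indep_setD[OF ind]) auto
qed

text \<open>By locality the miss event belongs to the field over \<open>[0, 1]\<close>, and it is
  independent of an intersection-stable system generating that field. Hence it is independent of
  itself, and its probability solves \<open>p = p * p\<close>.\<close>

lemma zero_one_miss: "prob (miss 0 1) = 0 \<or> prob (miss 0 1) = 1"
proof (rule ccontr)
  assume "\<not> ?thesis"
  then have ne: "prob (miss 0 1) \<noteq> 0" "prob (miss 0 1) \<noteq> 1" by auto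
  then have pos: "0 < prob (miss 0 1)" using measure_nonneg[of W "miss 0 1"] by linarith
  have mev: "miss 0 1 \<in> events" by (intro miss_events) simp
  have "indep_set {miss 0 1} (cylinder_system {0..1})"
  proof (rule indep_setI)
    show sub: "cylinder_system {0..1} \<subseteq> events" by (intro cylinder_system_events) auto
    fix a D assume a: "a \<in> {miss 0 1}" and "D \<in> cylinder_system {0..1}"
    then obtain C N T where D: "D = C \<inter> N" "finite T" "T \<subseteq> {0..1}" "C \<in> cylinder_field T"
      "N \<in> events" "prob N = 0 \<or> prob N = 1"
      unfolding cylinder_system_def by blast
    have "T \<subseteq> {0..}" using D(3) by auto
    then have C: "C \<in> events" using D(4) cylinder_field_events by blast
    have "miss 0 1 \<inter> D = (miss 0 1 \<inter> C) \<inter> N" using D by blast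
    then have "prob (miss 0 1 \<inter> D) = prob (miss 0 1 \<inter> C) * prob N"
      using mev C D by (simp add: prob_Int_trivial)
    also have "\<dots> = prob (miss 0 1) * prob D"
      using indep_miss_cylinder[OF pos D(2-4)] prob_Int_trivial[OF C D(5,6)] D(1) by simp
    finally show "prob (a \<inter> D) = prob a * prob D" using a by simp
  qed (use mev in auto)
  then have "indep_set (sigma_sets (space W) {miss 0 1}) (sigma_sets (space W) (cylinder_system {0..1}))"
    by (intro indep_set_sigma_sets Int_stable_cylinder_system) (simp_all add: Int_stable_def)
  moreover have "miss 0 1 \<in> sigma_sets (space W) (cylinder_system {0..1})"
    using miss_in_noise_field[of 0 1] noise_field_subset_cylinder_system by auto
  ultimately have "prob (miss 0 1 \<inter> miss 0 1) = prob (miss 0 1) * prob (miss 0 1)"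
    by (intro indep_setD[of "sigma_sets (space W) {miss 0 1}"]) auto
  then show False using ne by simp
qed

text \<open>If a power of the probability for length \<open>1 / Suc n\<close> vanishes, so does that
  probability. Translation places these intervals at all rational left ends, and this countable
  family has a member inside every neighbourhood of every point.\<close>

lemma dense_if_miss_null:
  assumes "prob (miss 0 1) = 0"
  shows "dense_random_set W M"
proof -
  have null: "prob (miss x (x + 1 / real (Suc n))) = 0" for x n
  proof -
    have "prob (miss 0 (1 / real (Suc n))) ^ Suc n = 0"
      using prob_miss_power[of 0 "1 / real (Suc n)" "Suc n"] assms by simp
    then have "prob (miss 0 (1 / real (Suc n))) = 0" by (simp only: power_eq_0_iff)
    then show ?thesis using prob_miss_translate[of "1 / real (Suc n)" x 0] by simp
  qed
  have "AE \<omega> in W. \<omega> \<notin> miss x (x + 1 / real (Suc n))" for x n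
    using null[of x n] by (subst prob_eq_0[symmetric]) (auto intro: miss_events)
  then have "AE \<omega> in W. \<forall>x\<in>\<rat>. \<forall>n. \<omega> \<notin> miss x (x + 1 / real (Suc n))"
    by (simp add: AE_ball_countable countable_rat AE_all_countable)
  then show ?thesis
    unfolding dense_random_set_def using AE_space
  proof eventually_elim
    case (elim \<omega>)
    have "y \<in> closure (M \<omega>)" for y
      unfolding closure_approachable
    proof (intro allI impI)
      fix e :: real assume e: "0 < e"
      then obtain n where n: "1 / real (Suc n) < e / 2" using nat_approx_posE[of "e / 2"] by auto
      \<comment> \<open>A left end less than \<open>e / 2\<close> below \<open>y\<close> and a
        length below \<open>e / 2\<close> keep the whole interval within \<open>e\<close> of
        \<open>y\<close>.\<close>
      obtain x where x: "x \<in> \<rat>" "y - e / 2 < x" "x < y"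
        using Rats_dense_in_real[of "y - e / 2" y] e by auto
      have "\<omega> \<notin> miss x (x + 1 / real (Suc n))" using elim x by blast
      then obtain z where "z \<in> M \<omega>" "x < z" "z < x + 1 / real (Suc n)"
        using elim by (auto simp: miss_def space_W)
      moreover have "dist z y < e" using calculation n x unfolding dist_real_def by linarith
      ultimately show "\<exists>z\<in>M \<omega>. dist z y < e" by blast
    qed
    then show ?case by auto
  qed
qed

text \<open>The unit intervals with rational left ends form a countable cover of the line by
  intervals that \<open>M\<close> almost surely misses.\<close>

lemma empty_if_miss_sure:
  assumes "prob (miss 0 1) = 1"
  shows "empty_random_set W M"
proof -
  have "prob (miss x (x + 1)) = 1" for x
    using prob_miss_translate[of 1 x 0] assms by simp
  then have "AE \<omega> in W. \<omega> \<in> miss x (x + 1)" for x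
    by (subst prob_eq_1[symmetric]) (auto intro: miss_events)
  then have "AE \<omega> in W. \<forall>x\<in>\<rat>. \<omega> \<in> miss x (x + 1)"
    by (simp add: AE_ball_countable countable_rat)
  then show ?thesis
    unfolding empty_random_set_def
  proof eventually_elim
    case (elim \<omega>)
    have "y \<notin> M \<omega>" for y
    proof -
      obtain x where x: "x \<in> \<rat>" "y - 1 < x" "x < y" using Rats_dense_in_real[of "y - 1" y] by auto
      then have "\<omega> \<in> miss x (x + 1)" "y \<in> {x<..<x + 1}" using elim by auto
      then show ?thesis unfolding miss_def by blast
    qed
    then show ?case by blast
  qed
qed

end

theorem proposition3p14:
  fixes W :: "(real \<Rightarrow> real) measure"
    and M :: "(real \<Rightarrow> real) \<Rightarrow> real set"
  assumes "completed_wiener_measure W"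
    and "random_countable_set W M"
    and "local_random_set W M"
    and "hit_or_miss_stationary W M"
  shows "dense_random_set W M \<or> empty_random_set W M"
proof -
  obtain P where P: "two_sided_wiener_measure P" "W = completion P"
    using assms(1) by (auto simp: completed_wiener_measure_def)
  interpret stationary_random_set W P M
    by unfold_locales (use P assms in auto)
  show ?thesis using zero_one_miss dense_if_miss_null empty_if_miss_sure by blast
qed

end
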